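(* Let $n\ge2$, let $(M,J)$ be an almost complex manifold of complex dimension $n$, and let $\nabla$ be a complex connection on $(M,J)$. The c-projective class $[\nabla]$ contains a minimal complex connection if and only if $\pi_4(T_\nabla)=0$, where $\pi_4(T_\nabla)$ is the traceless antilinear-linear part of the torsion $T_\nabla$; that is, if and only if $$\tfrac14\bigl(T_\nabla(X,Y)+JT_\nabla(JX,Y)-JT_\nabla(X,JY)+T_\nabla(JX,JY)\bigr)-\tfrac1{2n}\bigl(\varsigma(X)Y+\varsigma(JX)JY\bigr)=0$$ for all $X,Y$, where $\varsigma(X)=\frac12\operatorname{Tr}\bigl(T_\nabla(X,\cdot)+JT_\nabla(JX,\cdot)\bigr)$ (real trace).
   Context: A complex connection on $(M,J)$ is a linear connection $\nabla$ with $\nabla J=0$. It is minimal if $T_\nabla=\frac14N_J$, where $N_J(X,Y)=[JX,JY]-J[JX,Y]-J[X,JY]-[X,Y]$ is the Nijenhuis tensor; equivalently $T_\nabla$ equals its part that is complex-antilinear in both arguments. Two complex connections $\nabla,\bar\nabla$ on $(M,J)$ are c-projectively equivalent if they have the same $J$-planar curves (curves with $\nabla_{\dot\gamma}\dot\gamma\in\langle\dot\gamma,J\dot\gamma\rangle$), i.e. $\nabla_XX-\bar\nabla_XX\in\langle X,JX\rangle$ for all vector fields $X$; $[\nabla]$ is the equivalence class. *)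

theory Defs
  imports "HOL-Analysis.Analysis"
begin

section \<open>Smooth maps between open subsets of Euclidean spaces\<close>

text \<open>Meant for open sets \<open>S\<close>. In finite dimension, continuity of all iterated directional
  derivatives up to order \<open>k\<close> is the same as being of class \<open>C\<close>-\<open>k\<close>.\<close>

primrec k_smooth_on ::
  "nat \<Rightarrow> 'a::euclidean_space set \<Rightarrow> ('a \<Rightarrow> 'b::real_normed_vector) \<Rightarrow> bool"
where
  "k_smooth_on 0 S f \<longleftrightarrow> continuous_on S f"
| "k_smooth_on (Suc k) S f \<longleftrightarrow>
     (\<forall>x\<in>S. f differentiable at x) \<and>
     (\<forall>v. k_smooth_on k S (\<lambda>x. frechet_derivative f (at x) v))"

definition smooth_on ::
  "'a::euclidean_space set \<Rightarrow> ('a \<Rightarrow> 'b::real_normed_vector) \<Rightarrow> bool"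
  where "smooth_on S f \<longleftrightarrow> (\<forall>k. k_smooth_on k S f)"


section \<open>Smooth manifolds\<close>

text \<open>A manifold is a Hausdorff, second countable topological space (a type of the corresponding
  classes) with a smooth atlas \<open>A\<close>. A chart is a pair of its domain and its coordinate map;
  the coordinate map is only meaningful on the domain. The model space is \<open>real ^ 'k\<close>,
  so that the real dimension is \<open>CARD('k)\<close>.\<close>

type_synonym ('m, 'k) chart = "'m set \<times> ('m \<Rightarrow> real ^ 'k)"

definition cdom :: "('m, 'k::finite) chart \<Rightarrow> 'm set"
  where "cdom c = fst c"

definition cmap :: "('m, 'k::finite) chart \<Rightarrow> 'm \<Rightarrow> real ^ 'k"
  where "cmap c = snd c"

definition cinv :: "('m, 'k::finite) chart \<Rightarrow> real ^ 'k \<Rightarrow> 'm"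
  where "cinv c = inv_into (cdom c) (cmap c)"

definition smooth_atlas ::
  "('m::{t2_space, second_countable_topology}, 'k::finite) chart set \<Rightarrow> bool"
where
  "smooth_atlas A \<longleftrightarrow>
     (\<Union>c\<in>A. cdom c) = UNIV \<and>
     (\<forall>c\<in>A. open (cdom c) \<and> open (cmap c ` cdom c) \<and>
             homeomorphism (cdom c) (cmap c ` cdom c) (cmap c) (cinv c)) \<and>
     (\<forall>c\<in>A. \<forall>d\<in>A. smooth_on (cmap c ` (cdom c \<inter> cdom d)) (cmap d \<circ> cinv c))"

definition smooth_fun :: "('m, 'k::finite) chart set \<Rightarrow> ('m \<Rightarrow> real) \<Rightarrow> bool"
  where "smooth_fun A f \<longleftrightarrow> (\<forall>c\<in>A. smooth_on (cmap c ` cdom c) (f \<circ> cinv c))"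


section \<open>Tangent vectors and vector fields\<close>

text \<open>For every point \<open>p\<close> a chart \<open>chart_at A p\<close> around \<open>p\<close> is fixed once and for all, and a tangent
  vector at \<open>p\<close> is represented by its coordinates in that chart. Thus every tangent space is
  a copy of \<open>real ^ 'k\<close>, but vectors at different points can be compared only after
  transforming them to a common chart by \<open>coord_change\<close>, the derivative of the transition map.\<close>

definition chart_at :: "('m, 'k::finite) chart set \<Rightarrow> 'm \<Rightarrow> ('m, 'k) chart"
  where "chart_at A p = (SOME c. c \<in> A \<and> p \<in> cdom c)"

definition coord_change ::
  "('m, 'k::finite) chart \<Rightarrow> ('m, 'k) chart \<Rightarrow> 'm \<Rightarrow> real ^ 'k \<Rightarrow> real ^ 'k"
  where "coord_change c d p = frechet_derivative (cmap d \<circ> cinv c) (at (cmap c p))"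

type_synonym ('m, 'k) vfield = "'m \<Rightarrow> real ^ 'k"

definition local_rep ::
  "('m, 'k::finite) chart set \<Rightarrow> ('m, 'k) chart \<Rightarrow> ('m, 'k) vfield \<Rightarrow> real ^ 'k \<Rightarrow> real ^ 'k"
where
  "local_rep A c X x = coord_change (chart_at A (cinv c x)) c (cinv c x) (X (cinv c x))"

definition smooth_vfield :: "('m, 'k::finite) chart set \<Rightarrow> ('m, 'k) vfield \<Rightarrow> bool"
  where "smooth_vfield A X \<longleftrightarrow> (\<forall>c\<in>A. smooth_on (cmap c ` cdom c) (local_rep A c X))"

definition dir_deriv ::
  "('m, 'k::finite) chart set \<Rightarrow> ('m, 'k) vfield \<Rightarrow> ('m \<Rightarrow> real) \<Rightarrow> 'm \<Rightarrow> real"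
where
  "dir_deriv A X f p =
     (let c = chart_at A p in frechet_derivative (f \<circ> cinv c) (at (cmap c p)) (X p))"

text \<open>In coordinates, \<open>[X, Y] = DY(X) - DX(Y)\<close>.\<close>

definition lie_bracket ::
  "('m, 'k::finite) chart set \<Rightarrow> ('m, 'k) vfield \<Rightarrow> ('m, 'k) vfield \<Rightarrow> ('m, 'k) vfield"
where
  "lie_bracket A X Y p =
     (let c = chart_at A p; x = cmap c p in
        frechet_derivative (local_rep A c Y) (at x) (X p) -
        frechet_derivative (local_rep A c X) (at x) (Y p))"


section \<open>Almost complex structures and complex connections\<close>

type_synonym ('m, 'k) endofield = "'m \<Rightarrow> real ^ 'k \<Rightarrow> real ^ 'k"

definition app :: "('m, 'k::finite) endofield \<Rightarrow> ('m, 'k) vfield \<Rightarrow> ('m, 'k) vfield"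
  where "app J X = (\<lambda>p. J p (X p))"

text \<open>Smoothness of the field \<open>J\<close> is smoothness of its components in all charts.\<close>

definition almost_complex ::
  "('m, 'k::finite) chart set \<Rightarrow> ('m, 'k) endofield \<Rightarrow> bool"
where
  "almost_complex A J \<longleftrightarrow>
     (\<forall>p. linear (J p)) \<and>
     (\<forall>p v. J p (J p v) = - v) \<and>
     (\<forall>c\<in>A. \<forall>v. smooth_on (cmap c ` cdom c)
        (\<lambda>x. let p = cinv c x; d = chart_at A p in
               coord_change d c p (J p (coord_change c d p v))))"

text \<open>A linear connection as a covariant derivative operator; only its values on smooth vector
  fields matter.\<close>

type_synonym ('m, 'k) conn = "('m, 'k) vfield \<Rightarrow> ('m, 'k) vfield \<Rightarrow> ('m, 'k) vfield"

definition linear_connection ::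
  "('m, 'k::finite) chart set \<Rightarrow> ('m, 'k) conn \<Rightarrow> bool"
where
  "linear_connection A D \<longleftrightarrow>
     (\<forall>X Y. smooth_vfield A X \<longrightarrow> smooth_vfield A Y \<longrightarrow> smooth_vfield A (D X Y)) \<and>
     (\<forall>X X' Y. smooth_vfield A X \<longrightarrow> smooth_vfield A X' \<longrightarrow> smooth_vfield A Y \<longrightarrow>
        D (\<lambda>p. X p + X' p) Y = (\<lambda>p. D X Y p + D X' Y p)) \<and>
     (\<forall>f X Y. smooth_fun A f \<longrightarrow> smooth_vfield A X \<longrightarrow> smooth_vfield A Y \<longrightarrow>
        D (\<lambda>p. f p *\<^sub>R X p) Y = (\<lambda>p. f p *\<^sub>R D X Y p)) \<and>
     (\<forall>X Y Y'. smooth_vfield A X \<longrightarrow> smooth_vfield A Y \<longrightarrow> smooth_vfield A Y' \<longrightarrow>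
        D X (\<lambda>p. Y p + Y' p) = (\<lambda>p. D X Y p + D X Y' p)) \<and>
     (\<forall>f X Y. smooth_fun A f \<longrightarrow> smooth_vfield A X \<longrightarrow> smooth_vfield A Y \<longrightarrow>
        D X (\<lambda>p. f p *\<^sub>R Y p) = (\<lambda>p. dir_deriv A X f p *\<^sub>R Y p + f p *\<^sub>R D X Y p))"

text \<open>The last condition says that the covariant derivative of \<open>J\<close> vanishes.\<close>

definition complex_connection ::
  "('m, 'k::finite) chart set \<Rightarrow> ('m, 'k) endofield \<Rightarrow> ('m, 'k) conn \<Rightarrow> bool"
where
  "complex_connection A J D \<longleftrightarrow>
     linear_connection A D \<and>
     (\<forall>X Y. smooth_vfield A X \<longrightarrow> smooth_vfield A Y \<longrightarrow> D X (app J Y) = app J (D X Y))"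

definition torsion ::
  "('m, 'k::finite) chart set \<Rightarrow> ('m, 'k) conn \<Rightarrow>
   ('m, 'k) vfield \<Rightarrow> ('m, 'k) vfield \<Rightarrow> ('m, 'k) vfield"
  where "torsion A D X Y p = D X Y p - D Y X p - lie_bracket A X Y p"

definition nijenhuis ::
  "('m, 'k::finite) chart set \<Rightarrow> ('m, 'k) endofield \<Rightarrow>
   ('m, 'k) vfield \<Rightarrow> ('m, 'k) vfield \<Rightarrow> ('m, 'k) vfield"
where
  "nijenhuis A J X Y p =
     lie_bracket A (app J X) (app J Y) p
     - J p (lie_bracket A (app J X) Y p)
     - J p (lie_bracket A X (app J Y) p)
     - lie_bracket A X Y p"

definition minimal_connection ::
  "('m, 'k::finite) chart set \<Rightarrow> ('m, 'k) endofield \<Rightarrow> ('m, 'k) conn \<Rightarrow> bool"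
where
  "minimal_connection A J D \<longleftrightarrow>
     (\<forall>X Y p. smooth_vfield A X \<longrightarrow> smooth_vfield A Y \<longrightarrow>
        torsion A D X Y p = (1/4) *\<^sub>R nijenhuis A J X Y p)"


section \<open>C-projective classes\<close>

text \<open>Two complex connections are c-projectively equivalent when they have the same \<open>J\<close>-planar
  curves, i.e. when their difference evaluated on \<open>(X, X)\<close> lies pointwise in the real span of
  \<open>X\<close> and \<open>JX\<close> for all vector fields \<open>X\<close>; the latter form is taken as the definition.\<close>

definition cproj_equiv ::
  "('m, 'k::finite) chart set \<Rightarrow> ('m, 'k) endofield \<Rightarrow> ('m, 'k) conn \<Rightarrow> ('m, 'k) conn \<Rightarrow> bool"
where
  "cproj_equiv A J D D' \<longleftrightarrow>
     (\<forall>X p. smooth_vfield A X \<longrightarrow> D X X p - D' X X p \<in> span {X p, J p (X p)})"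

definition cproj_class ::
  "('m, 'k::finite) chart set \<Rightarrow> ('m, 'k) endofield \<Rightarrow> ('m, 'k) conn \<Rightarrow> ('m, 'k) conn set"
  where "cproj_class A J D = {D'. complex_connection A J D' \<and> cproj_equiv A J D D'}"


section \<open>The traceless antilinear-linear part of the torsion\<close>

text \<open>An operator \<open>F\<close> on vector fields that is linear over smooth functions induces
  an endomorphism of each tangent space: evaluate \<open>F\<close> at \<open>p\<close> on any smooth extension of the
  given vector. Its trace may be computed in the coordinates of the chart \<open>chart_at A p\<close>.\<close>

definition endo_at ::
  "('m, 'k::finite) chart set \<Rightarrow> (('m, 'k) vfield \<Rightarrow> ('m, 'k) vfield) \<Rightarrow> 'm \<Rightarrow>
   real ^ 'k \<Rightarrow> real ^ 'k"
  where "endo_at A F p v = F (SOME V. smooth_vfield A V \<and> V p = v) p"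

definition Tr ::
  "('m, 'k::finite) chart set \<Rightarrow> (('m, 'k) vfield \<Rightarrow> ('m, 'k) vfield) \<Rightarrow> 'm \<Rightarrow> real"
  where "Tr A F p = trace (matrix (endo_at A F p))"

definition varsigma ::
  "('m, 'k::finite) chart set \<Rightarrow> ('m, 'k) endofield \<Rightarrow> ('m, 'k) conn \<Rightarrow>
   ('m, 'k) vfield \<Rightarrow> 'm \<Rightarrow> real"
where
  "varsigma A J D X p =
     1/2 * Tr A (\<lambda>V q. torsion A D X V q + J q (torsion A D (app J X) V q)) p"

definition pi4_torsion ::
  "nat \<Rightarrow> ('m, 'k::finite) chart set \<Rightarrow> ('m, 'k) endofield \<Rightarrow> ('m, 'k) conn \<Rightarrow>
   ('m, 'k) vfield \<Rightarrow> ('m, 'k) vfield \<Rightarrow> ('m, 'k) vfield"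
where
  "pi4_torsion n A J D X Y p =
     (1/4) *\<^sub>R (torsion A D X Y p
              + J p (torsion A D (app J X) Y p)
              - J p (torsion A D X (app J Y) p)
              + torsion A D (app J X) (app J Y) p)
     - (1 / (2 * real n)) *\<^sub>R
         (varsigma A J D X p *\<^sub>R Y p + varsigma A J D (app J X) p *\<^sub>R J p (Y p))"

end

theory Submission
  imports Defs
begin

text \<open>Split the torsion \<open>T\<close> of a complex connection \<open>D\<close> by complex type. The part that is
  antilinear in both arguments is always a quarter of the Nijenhuis tensor, so \<open>D\<close> is minimal iff
  the other parts vanish. Subtracting from \<open>D\<close> half of the complex bilinear part and the
  antilinear-linear part \<open>T11\<close> always gives a minimal complex connection. The
  complex bilinear part is skew, so this connection is c-projectively equivalent to \<open>D\<close> as soon as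
  \<open>T11 X X\<close> is a multiple of \<open>X\<close> and \<open>J X\<close>, which \<open>\<pi>\<^sub>4 = 0\<close> guarantees.

  Conversely, if \<open>D'\<close> is minimal and equivalent to \<open>D\<close>, then \<open>2 T11\<close> is the sesquilinear map
  \<open>Q X Y = B X Y + J (B (J X) Y)\<close> with \<open>B = D - D'\<close>. Since \<open>Q X X\<close> is a complex multiple of
  \<open>X\<close> for all \<open>X\<close>, polarisation shows that \<open>Q X\<close> is multiplication by a complex scalar. This scalar
  is recovered by the traces in \<open>varsigma\<close>, so \<open>\<pi>\<^sub>4\<close> vanishes. The argument is pointwise once the
  torsion and \<open>B\<close> are known to be tensorial, which needs bump functions; smoothness of the
  torsion needs that the coordinate formula for the Lie bracket is independent of the chart.\<close>

section \<open>Smooth maps\<close>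

text \<open>A derivative at a point depends on a whole neighbourhood. Since \<open>S\<close> is
  open, agreement on \<open>S\<close> passes to the directional derivatives, and the induction
  proceeds with those.\<close>

lemma k_smooth_on_cong:
  assumes "open S" "\<And>x. x \<in> S \<Longrightarrow> f x = g x" "k_smooth_on k S f"
  shows "k_smooth_on k S g"
  using assms
proof (induction k arbitrary: f g)
  case 0
  then show ?case using continuous_on_cong by force
next
  case (Suc k)
  have d: "f differentiable at x" if "x \<in> S" for x using Suc.prems that by simp
  have fg: "frechet_derivative f (at x) = frechet_derivative g (at x)" if "x \<in> S" for x
    using frechet_derivative_transform_within_open[OF d[OF that] Suc.prems(1) that Suc.prems(2)] .
  have "g differentiable at x" if "x \<in> S" for x
    using d[OF that] Suc.prems(1,2) that unfolding differentiable_def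
    by (metis has_derivative_transform_within_open)
  moreover have "k_smooth_on k S (\<lambda>x. frechet_derivative g (at x) v)" for v
    by (rule Suc.IH[of "\<lambda>x. frechet_derivative f (at x) v"]) (use Suc.prems fg in auto)
  ultimately show ?case by simp
qed

text \<open>\<open>frechet_derivative\<close> is a choice term. Uniqueness of derivatives replaces
  it by an explicit formula \<open>f' x\<close>, which is how the calculus rules below enter the
  inductions.\<close>

lemma k_smooth_on_SucI:
  assumes "open S" "\<And>x. x \<in> S \<Longrightarrow> (f has_derivative f' x) (at x)"
    and "\<And>v. k_smooth_on k S (\<lambda>x. f' x v)"
  shows "k_smooth_on (Suc k) S f"
proof -
  have "frechet_derivative f (at x) = f' x" if "x \<in> S" for x
    using frechet_derivative_at[OF assms(2)[OF that]] by simp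
  then have "k_smooth_on k S (\<lambda>x. frechet_derivative f (at x) v)" for v
    by (intro k_smooth_on_cong[OF assms(1) _ assms(3)]) simp
  then show ?thesis using assms(2) by (auto simp: differentiable_def)
qed

lemma k_smooth_on_has_derivative:
  assumes "k_smooth_on (Suc k) S f" "x \<in> S"
  shows "(f has_derivative frechet_derivative f (at x)) (at x)"
  using assms frechet_derivative_works by auto

lemma k_smooth_on_lower:
  "k_smooth_on (Suc k) S f \<Longrightarrow> k_smooth_on k S f"
proof (induction k arbitrary: f)
  case 0
  then show ?case
    by (simp add: continuous_at_imp_continuous_on differentiable_imp_continuous_within)
next
  case (Suc k)
  have "k_smooth_on k S (\<lambda>x. frechet_derivative f (at x) v)" for v
    using Suc.prems by (intro Suc.IH) (metis k_smooth_on.simps(2))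
  moreover have "\<forall>x\<in>S. f differentiable at x" using Suc.prems by simp
  ultimately show ?case by simp
qed

lemma k_smooth_on_subset:
  "k_smooth_on k S f \<Longrightarrow> T \<subseteq> S \<Longrightarrow> k_smooth_on k T f"
  by (induction k arbitrary: f) (auto intro: continuous_on_subset)

lemma k_smooth_on_Un:
  "k_smooth_on k S f \<Longrightarrow> k_smooth_on k T f \<Longrightarrow> open S \<Longrightarrow> open T \<Longrightarrow> k_smooth_on k (S \<union> T) f"
  by (induction k arbitrary: f) (auto intro: continuous_on_open_Un)

lemma k_smooth_on_const: "k_smooth_on k S (\<lambda>x. c)"
  by (induction k arbitrary: c) auto

lemma k_smooth_on_linear_compose:
  assumes "bounded_linear L" "open S" "k_smooth_on k S f"
  shows "k_smooth_on k S (\<lambda>x. L (f x))"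
  using assms(3)
proof (induction k arbitrary: f)
  case 0
  then show ?case using assms(1) by (simp add: bounded_linear.continuous_on)
next
  case (Suc k)
  show ?case
  proof (rule k_smooth_on_SucI[OF assms(2)])
    fix x assume "x \<in> S"
    show "((\<lambda>x. L (f x)) has_derivative (\<lambda>v. L (frechet_derivative f (at x) v))) (at x)"
      using bounded_linear.has_derivative[OF assms(1) k_smooth_on_has_derivative[OF Suc.prems \<open>x \<in> S\<close>]] .
  qed (use Suc in auto)
qed

lemma k_smooth_on_add:
  assumes "open S" "k_smooth_on k S f" "k_smooth_on k S g"
  shows "k_smooth_on k S (\<lambda>x. f x + g x)"
  using assms(2,3)
proof (induction k arbitrary: f g)
  case 0
  then show ?case by (simp add: continuous_on_add)
next
  case (Suc k)
  show ?case
  proof (rule k_smooth_on_SucI[OF assms(1)])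
    fix x assume "x \<in> S"
    show "((\<lambda>x. f x + g x) has_derivative
        (\<lambda>v. frechet_derivative f (at x) v + frechet_derivative g (at x) v)) (at x)"
      using \<open>x \<in> S\<close> Suc.prems by (intro has_derivative_add) (auto simp: k_smooth_on_has_derivative)
  qed (use Suc in auto)
qed

lemma k_smooth_on_sum:
  assumes "open S" "\<And>i. i \<in> I \<Longrightarrow> k_smooth_on k S (f i)"
  shows "k_smooth_on k S (\<lambda>x. \<Sum>i\<in>I. f i x)"
  using assms(2)
  by (induction I rule: infinite_finite_induct)
    (auto intro: k_smooth_on_add k_smooth_on_const assms(1))

text \<open>Product rule: each summand of the derivative pairs an undifferentiated factor with a
  derivative, so the former has to be lowered to order \<open>k\<close> before the induction
  hypothesis applies.\<close>

lemma k_smooth_on_bilinear: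
  assumes "bounded_bilinear h" "open S" "k_smooth_on k S f" "k_smooth_on k S g"
  shows "k_smooth_on k S (\<lambda>x. h (f x) (g x))"
  using assms(3,4)
proof (induction k arbitrary: f g)
  case 0
  then show ?case using assms(1) by (simp add: bounded_bilinear.continuous_on)
next
  case (Suc k)
  show ?case
  proof (rule k_smooth_on_SucI[OF assms(2)])
    fix x assume "x \<in> S"
    show "((\<lambda>x. h (f x) (g x)) has_derivative
        (\<lambda>v. h (f x) (frechet_derivative g (at x) v) + h (frechet_derivative f (at x) v) (g x))) (at x)"
      using \<open>x \<in> S\<close> Suc.prems
      by (intro bounded_bilinear.FDERIV[OF assms(1)]) (auto simp: k_smooth_on_has_derivative)
  next
    fix v
    have "k_smooth_on k S f" "k_smooth_on k S g"
      using Suc.prems k_smooth_on_lower by blast+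
    then show "k_smooth_on k S (\<lambda>x. h (f x) (frechet_derivative g (at x) v) +
         h (frechet_derivative f (at x) v) (g x))"
      using Suc.prems by (intro k_smooth_on_add[OF assms(2)] Suc.IH) simp_all
  qed
qed

lemmas k_smooth_on_scaleR = k_smooth_on_bilinear[OF bounded_bilinear_scaleR]

lemma linear_eq_sum_Basis:
  fixes u :: "'a::euclidean_space"
  assumes "linear L"
  shows "L u = (\<Sum>b\<in>Basis. (u \<bullet> b) *\<^sub>R L b)"
proof -
  have "L u = L (\<Sum>b\<in>Basis. (u \<bullet> b) *\<^sub>R b)" by (simp add: euclidean_representation)
  also have "\<dots> = (\<Sum>b\<in>Basis. (u \<bullet> b) *\<^sub>R L b)"
    by (simp add: linear_sum[OF assms] linear_scale[OF assms])
  finally show ?thesis .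
qed

text \<open>Regularity of \<open>L x v\<close> is known for fixed \<open>v\<close> only. Expanding a
  moving argument \<open>u x\<close> in \<open>Basis\<close> leaves a finite sum of products of
  scalar coordinates with values at fixed vectors.\<close>

lemma k_smooth_on_linear_apply:
  fixes u :: "'a::euclidean_space \<Rightarrow> 'b::euclidean_space"
  assumes "open S" "\<And>x. x \<in> S \<Longrightarrow> linear (L x)" "\<And>v. k_smooth_on k S (\<lambda>x. L x v)"
    and "k_smooth_on k S u"
  shows "k_smooth_on k S (\<lambda>x. L x (u x))"
proof (rule k_smooth_on_cong[OF assms(1)])
  show "(\<Sum>b\<in>Basis. (u x \<bullet> b) *\<^sub>R L x b) = L x (u x)" if "x \<in> S" for x
    by (rule linear_eq_sum_Basis[OF assms(2)[OF that], symmetric])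
  show "k_smooth_on k S (\<lambda>x. \<Sum>b\<in>Basis. (u x \<bullet> b) *\<^sub>R L x b)"
    by (intro k_smooth_on_sum k_smooth_on_scaleR assms
        k_smooth_on_linear_compose[OF bounded_linear_inner_left])
qed

lemma k_smooth_on_frechet_derivative_apply:
  fixes u :: "'a::euclidean_space \<Rightarrow> 'a"
  assumes "open S" "k_smooth_on (Suc k) S f" "k_smooth_on k S u"
  shows "k_smooth_on k S (\<lambda>x. frechet_derivative f (at x) (u x))"
proof (rule k_smooth_on_linear_apply[OF assms(1) _ _ assms(3)])
  show "linear (frechet_derivative f (at x))" if "x \<in> S" for x
    using assms(2) that by (simp add: linear_frechet_derivative)
  show "k_smooth_on k S (\<lambda>x. frechet_derivative f (at x) v)" for v
    using assms(2) by simp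
qed

text \<open>Chain rule and induction. \<open>f\<close> is generalised so that the hypothesis also
  covers the directional derivatives of \<open>f\<close>, while \<open>g\<close> is reused at lower
  order.\<close>

lemma k_smooth_on_compose:
  fixes g :: "'a::euclidean_space \<Rightarrow> 'b::euclidean_space"
  assumes "open S" "open T" "g ` S \<subseteq> T" "k_smooth_on k T f" "k_smooth_on k S g"
  shows "k_smooth_on k S (\<lambda>x. f (g x))"
  using assms(4,5)
proof (induction k arbitrary: f)
  case 0
  then show ?case using assms(3) by (auto intro: continuous_on_compose2)
next
  case (Suc k)
  have T: "g x \<in> T" if "x \<in> S" for x using assms(3) that by auto
  show ?case
  proof (rule k_smooth_on_SucI[OF assms(1)])
    fix x assume x: "x \<in> S"
    show "((\<lambda>x. f (g x)) has_derivative
        (\<lambda>v. frechet_derivative f (at (g x)) (frechet_derivative g (at x) v))) (at x)"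
      by (rule has_derivative_compose[OF k_smooth_on_has_derivative[OF Suc.prems(2) x]
            k_smooth_on_has_derivative[OF Suc.prems(1) T[OF x]]])
  next
    fix v
    show "k_smooth_on k S (\<lambda>x. frechet_derivative f (at (g x)) (frechet_derivative g (at x) v))"
    proof (rule k_smooth_on_linear_apply[OF assms(1)])
      show "linear (frechet_derivative f (at (g x)))" if "x \<in> S" for x
        using Suc.prems(1) T[OF that] by (simp add: linear_frechet_derivative)
      show "k_smooth_on k S (\<lambda>x. frechet_derivative f (at (g x)) w)" for w
        by (rule Suc.IH[OF _ k_smooth_on_lower[OF Suc.prems(2)]]) (use Suc.prems(1) in simp)
      show "k_smooth_on k S (\<lambda>x. frechet_derivative g (at x) v)"
        using Suc.prems(2) by simp
    qed
  qed
qed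

section \<open>Smoothness of all orders\<close>

lemma smooth_on_cong:
  "open S \<Longrightarrow> smooth_on S f \<Longrightarrow> (\<And>x. x \<in> S \<Longrightarrow> f x = g x) \<Longrightarrow> smooth_on S g"
  unfolding smooth_on_def using k_smooth_on_cong by blast

lemma smooth_on_subset: "smooth_on S f \<Longrightarrow> T \<subseteq> S \<Longrightarrow> smooth_on T f"
  unfolding smooth_on_def using k_smooth_on_subset by blast

lemma smooth_on_Un:
  "smooth_on S f \<Longrightarrow> smooth_on T f \<Longrightarrow> open S \<Longrightarrow> open T \<Longrightarrow> smooth_on (S \<union> T) f"
  unfolding smooth_on_def using k_smooth_on_Un by blast

lemma smooth_on_const [simp]: "smooth_on S (\<lambda>x. c)"
  unfolding smooth_on_def using k_smooth_on_const by blast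

lemma smooth_on_linear_compose:
  "bounded_linear L \<Longrightarrow> open S \<Longrightarrow> smooth_on S f \<Longrightarrow> smooth_on S (\<lambda>x. L (f x))"
  unfolding smooth_on_def using k_smooth_on_linear_compose by blast

lemma smooth_on_ident: "open S \<Longrightarrow> smooth_on S (\<lambda>x. x)"
  unfolding smooth_on_def
proof
  fix k assume "open S"
  then show "k_smooth_on k S (\<lambda>x. x)"
    by (cases k) (simp_all add: k_smooth_on_const)
qed

lemma smooth_on_add:
  "open S \<Longrightarrow> smooth_on S f \<Longrightarrow> smooth_on S g \<Longrightarrow> smooth_on S (\<lambda>x. f x + g x)"
  unfolding smooth_on_def using k_smooth_on_add by blast

lemma smooth_on_diff:
  assumes "open S" "smooth_on S f" "smooth_on S g" shows "smooth_on S (\<lambda>x. f x - g x)"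
  using smooth_on_add[OF assms(1,2) smooth_on_linear_compose[OF bounded_linear_minus[OF bounded_linear_ident] assms(1,3)]]
  by simp

lemma smooth_on_scaleR:
  "open S \<Longrightarrow> smooth_on S f \<Longrightarrow> smooth_on S g \<Longrightarrow> smooth_on S (\<lambda>x. f x *\<^sub>R g x)"
  unfolding smooth_on_def using k_smooth_on_scaleR by blast

lemma smooth_on_inner:
  "open S \<Longrightarrow> smooth_on S f \<Longrightarrow> smooth_on S g \<Longrightarrow> smooth_on S (\<lambda>x. f x \<bullet> g x)"
  unfolding smooth_on_def using k_smooth_on_bilinear[OF bounded_bilinear_inner] by blast

lemma smooth_on_linear_apply:
  fixes u :: "'a::euclidean_space \<Rightarrow> 'b::euclidean_space"
  assumes "open S" "\<And>x. x \<in> S \<Longrightarrow> linear (L x)" "\<And>v. smooth_on S (\<lambda>x. L x v)" "smooth_on S u"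
  shows "smooth_on S (\<lambda>x. L x (u x))"
  using assms unfolding smooth_on_def by (blast intro: k_smooth_on_linear_apply)

lemma smooth_on_frechet_derivative_apply:
  fixes u :: "'a::euclidean_space \<Rightarrow> 'a"
  assumes "open S" "smooth_on S f" "smooth_on S u"
  shows "smooth_on S (\<lambda>x. frechet_derivative f (at x) (u x))"
  using assms unfolding smooth_on_def by (blast intro: k_smooth_on_frechet_derivative_apply)

lemma smooth_on_compose:
  fixes g :: "'a::euclidean_space \<Rightarrow> 'b::euclidean_space"
  assumes "open S" "open T" "g ` S \<subseteq> T" "smooth_on T f" "smooth_on S g"
  shows "smooth_on S (\<lambda>x. f (g x))"
  using assms unfolding smooth_on_def by (blast intro: k_smooth_on_compose)

lemma smooth_on_differentiable: "smooth_on S f \<Longrightarrow> x \<in> S \<Longrightarrow> f differentiable at x"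
  unfolding smooth_on_def by (metis k_smooth_on.simps(2))

lemma smooth_on_has_derivative:
  "smooth_on S f \<Longrightarrow> x \<in> S \<Longrightarrow> (f has_derivative frechet_derivative f (at x)) (at x)"
  using smooth_on_differentiable frechet_derivative_works by blast

lemma smooth_on_continuous: "smooth_on S f \<Longrightarrow> continuous_on S f"
  unfolding smooth_on_def by (metis k_smooth_on.simps(1))

lemma smooth_on_directional:
  "smooth_on S f \<Longrightarrow> smooth_on S (\<lambda>x. frechet_derivative f (at x) v)"
  unfolding smooth_on_def by (metis k_smooth_on.simps(2))

subsection \<open>Symmetry of second derivatives\<close>

text \<open>Mean value theorem twice. The second difference is symmetric in \<open>u\<close> and
  \<open>v\<close>, whereas the right-hand side differentiates along \<open>u\<close> first and
  along \<open>v\<close> second; comparing both orders gives the symmetry of second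
  derivatives.\<close>

lemma second_difference_mean_value:
  fixes f :: "'a::real_normed_vector \<Rightarrow> real"
  assumes f: "\<And>y. y \<in> ball x r \<Longrightarrow> (f has_derivative f' y) (at y)"
    and g: "\<And>y. y \<in> ball x r \<Longrightarrow> ((\<lambda>z. f' z u) has_derivative g y) (at y)"
    and h: "0 < h" "h * (norm u + norm v) < r"
  shows "\<exists>y\<in>ball x r. f (x + h *\<^sub>R u + h *\<^sub>R v) - f (x + h *\<^sub>R u) - f (x + h *\<^sub>R v) + f x = h * h * g y v"
proof -
  have in_ball: "x + s *\<^sub>R u + t *\<^sub>R v \<in> ball x r" if "0 \<le> s" "s \<le> h" "0 \<le> t" "t \<le> h" for s t
  proof -
    have "norm (s *\<^sub>R u + t *\<^sub>R v) \<le> s * norm u + t * norm v"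
      using that by (metis abs_of_nonneg norm_scaleR norm_triangle_ineq)
    also have "\<dots> \<le> h * norm u + h * norm v"
      using that by (intro add_mono mult_right_mono) auto
    finally have "norm (s *\<^sub>R u + t *\<^sub>R v) < r" using h by (simp add: algebra_simps)
    moreover have "dist x (x + s *\<^sub>R u + t *\<^sub>R v) = norm (s *\<^sub>R u + t *\<^sub>R v)"
      by (metis ab_semigroup_add_class.add_ac(1) add_diff_cancel_left' dist_commute dist_norm)
    ultimately show ?thesis by simp
  qed
  \<comment> \<open>The second difference is the increment of this function from \<open>0\<close> to
    \<open>h\<close>.\<close>
  let ?\<phi> = "\<lambda>s. f (x + s *\<^sub>R u + h *\<^sub>R v) - f (x + s *\<^sub>R u)"
  have d\<phi>: "(?\<phi> has_derivative (\<lambda>k. f' (x + s *\<^sub>R u + h *\<^sub>R v) (k *\<^sub>R u) - f' (x + s *\<^sub>R u) (k *\<^sub>R u))) (at s)"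
    if "0 \<le> s" "s \<le> h" for s
  proof -
    have b: "x + s *\<^sub>R u + h *\<^sub>R v \<in> ball x r" "x + s *\<^sub>R u \<in> ball x r"
      using in_ball[of s h] in_ball[of s 0] that h by auto
    have "((\<lambda>s. x + s *\<^sub>R u + h *\<^sub>R v) has_derivative (\<lambda>k. k *\<^sub>R u)) (at s)"
      "((\<lambda>s. x + s *\<^sub>R u) has_derivative (\<lambda>k. k *\<^sub>R u)) (at s)"
      by (auto intro!: derivative_eq_intros)
    from has_derivative_compose[OF this(1), of f, OF f[OF b(1)]]
      has_derivative_compose[OF this(2), of f, OF f[OF b(2)]]
    show ?thesis by (rule has_derivative_diff)
  qed
  obtain \<xi> where \<xi>: "0 < \<xi>" "\<xi> < h"
    and \<phi>: "?\<phi> h - ?\<phi> 0 = f' (x + \<xi> *\<^sub>R u + h *\<^sub>R v) (h *\<^sub>R u) - f' (x + \<xi> *\<^sub>R u) (h *\<^sub>R u)"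
    using mvt_simple[OF h(1) has_derivative_at_withinI[OF d\<phi>]] by auto
  have f'_scale: "f' y (h *\<^sub>R u) = h * f' y u" if "y \<in> ball x r" for y
    using linear_scale[OF has_derivative_linear[OF f[OF that]]] by simp
  \<comment> \<open>The first mean value leaves an increment in direction \<open>v\<close> of the
    derivative along \<open>u\<close>, to which the theorem is applied again.\<close>
  let ?\<psi> = "\<lambda>t. f' (x + \<xi> *\<^sub>R u + t *\<^sub>R v) u"
  have d\<psi>: "(?\<psi> has_derivative (\<lambda>k. g (x + \<xi> *\<^sub>R u + t *\<^sub>R v) (k *\<^sub>R v))) (at t)"
    if "0 \<le> t" "t \<le> h" for t
  proof -
    have "((\<lambda>t. x + \<xi> *\<^sub>R u + t *\<^sub>R v) has_derivative (\<lambda>k. k *\<^sub>R v)) (at t)"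
      by (auto intro!: derivative_eq_intros)
    moreover have "x + \<xi> *\<^sub>R u + t *\<^sub>R v \<in> ball x r" using in_ball[of \<xi> t] that \<xi> by auto
    ultimately show ?thesis
      using has_derivative_compose[of _ _ _ UNIV "\<lambda>z. f' z u", OF _ g] by simp
  qed
  obtain \<eta> where \<eta>: "0 < \<eta>" "\<eta> < h"
    and \<psi>: "?\<psi> h - ?\<psi> 0 = g (x + \<xi> *\<^sub>R u + \<eta> *\<^sub>R v) (h *\<^sub>R v)"
    using mvt_simple[OF h(1) has_derivative_at_withinI[OF d\<psi>]] by auto
  have b: "x + \<xi> *\<^sub>R u + \<eta> *\<^sub>R v \<in> ball x r" "x + \<xi> *\<^sub>R u + h *\<^sub>R v \<in> ball x r" "x + \<xi> *\<^sub>R u \<in> ball x r"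
    using in_ball[of \<xi> \<eta>] in_ball[of \<xi> h] in_ball[of \<xi> 0] \<xi> \<eta> by auto
  have "?\<phi> h - ?\<phi> 0 = h * (?\<psi> h - ?\<psi> 0)"
    using \<phi> f'_scale b by (simp add: algebra_simps)
  also have "\<dots> = h * (h * g (x + \<xi> *\<^sub>R u + \<eta> *\<^sub>R v) v)"
    using \<psi> linear_scale[OF has_derivative_linear[OF g[OF b(1)]]] by simp
  finally show ?thesis using b(1) by (intro bexI[of _ "x + \<xi> *\<^sub>R u + \<eta> *\<^sub>R v"]) auto
qed

text \<open>Both mixed derivatives, taken at suitable points near \<open>x\<close>, equal the same
  second difference divided by \<open>h * h\<close>. Their continuity at \<open>x\<close> makes the
  values there arbitrarily close.\<close>

lemma second_derivative_symmetric_real: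
  fixes f :: "'a::euclidean_space \<Rightarrow> real"
  assumes S: "open S" "x \<in> S" and f: "smooth_on S f"
  shows "frechet_derivative (\<lambda>y. frechet_derivative f (at y) u) (at x) v =
         frechet_derivative (\<lambda>y. frechet_derivative f (at y) v) (at x) u"
proof -
  define G where "G u v y = frechet_derivative (\<lambda>z. frechet_derivative f (at z) u) (at y) v" for u v y
  have cont: "continuous_on S (G u v)" for u v
    unfolding G_def by (intro smooth_on_continuous smooth_on_directional f)
  have "\<bar>G u v x - G v u x\<bar> \<le> e" if "e > 0" for e
  proof -
    have near: "\<exists>r>0. \<forall>y\<in>S. dist y x < r \<longrightarrow> dist (G u v y) (G u v x) < e / 2" for u v
      using cont[of u v] S(2) \<open>e > 0\<close> unfolding continuous_on_iff by (metis half_gt_zero)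
    obtain r1 where r1: "r1 > 0" "\<And>y. y \<in> S \<Longrightarrow> dist y x < r1 \<Longrightarrow> dist (G u v y) (G u v x) < e / 2"
      using near[of u v] by auto
    obtain r2 where r2: "r2 > 0" "\<And>y. y \<in> S \<Longrightarrow> dist y x < r2 \<Longrightarrow> dist (G v u y) (G v u x) < e / 2"
      using near[of v u] by auto
    obtain r3 where r3: "r3 > 0" "ball x r3 \<subseteq> S" using S open_contains_ball by blast
    define r where "r = min r1 (min r2 r3)"
    have r: "r > 0" "r \<le> r1" "r \<le> r2" "ball x r \<subseteq> S"
      using r1 r2 r3 by (auto simp: r_def)
    \<comment> \<open>Small enough for the parallelogram spanned by \<open>h u\<close> and
      \<open>h v\<close> to stay in the ball; the summand 1 keeps the denominator positive when
      \<open>u = v = 0\<close>.\<close>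
    define h where "h = r / (2 * (norm u + norm v + 1))"
    have pos: "norm u + norm v + 1 > 0" by (simp add: add_nonneg_pos)
    have h: "h > 0" using r pos by (simp add: h_def)
    have "h * (norm u + norm v) < h * (2 * (norm u + norm v + 1))"
      using h pos by (intro mult_strict_left_mono) simp_all
    also have "\<dots> = r" using pos by (simp add: h_def)
    finally have hr: "h * (norm u + norm v) < r" .
    then have hr': "h * (norm v + norm u) < r" by (simp add: add.commute)
    have d1: "(f has_derivative frechet_derivative f (at y)) (at y)" if "y \<in> ball x r" for y
      using smooth_on_has_derivative[OF f] r that by blast
    have d2: "((\<lambda>z. frechet_derivative f (at z) w) has_derivative
        frechet_derivative (\<lambda>z. frechet_derivative f (at z) w) (at y)) (at y)" if "y \<in> ball x r" for y w
      using smooth_on_has_derivative[OF smooth_on_directional[OF f]] r that by blast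
    obtain y1 where y1: "y1 \<in> ball x r"
      "f (x + h *\<^sub>R u + h *\<^sub>R v) - f (x + h *\<^sub>R u) - f (x + h *\<^sub>R v) + f x = h * h * G u v y1"
      using second_difference_mean_value[OF d1 d2 h hr] unfolding G_def by blast
    obtain y2 where y2: "y2 \<in> ball x r"
      "f (x + h *\<^sub>R v + h *\<^sub>R u) - f (x + h *\<^sub>R v) - f (x + h *\<^sub>R u) + f x = h * h * G v u y2"
      using second_difference_mean_value[OF d1 d2 h hr'] unfolding G_def by blast
    have "x + h *\<^sub>R v + h *\<^sub>R u = x + h *\<^sub>R u + h *\<^sub>R v" by (simp add: algebra_simps)
    from y1(2) y2(2)[unfolded this] have "h * h * G u v y1 = h * h * G v u y2" by linarith
    then have "G u v y1 = G v u y2" using h by simp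
    moreover have "dist (G u v y1) (G u v x) < e / 2" using y1 r r1(2)[of y1] by (auto simp: dist_commute)
    moreover have "dist (G v u y2) (G v u x) < e / 2" using y2 r r2(2)[of y2] by (auto simp: dist_commute)
    ultimately show ?thesis unfolding dist_real_def by linarith
  qed
  then have "\<bar>G u v x - G v u x\<bar> \<le> 0" by (meson dense_ge)
  then show ?thesis by (simp add: G_def)
qed

lemma frechet_derivative_linear_compose:
  assumes "bounded_linear L" "f differentiable at x"
  shows "frechet_derivative (\<lambda>y. L (f y)) (at x) v = L (frechet_derivative f (at x) v)"
proof -
  have "((\<lambda>y. L (f y)) has_derivative (\<lambda>v. L (frechet_derivative f (at x) v))) (at x)"
    using bounded_linear.has_derivative[OF assms(1)] assms(2) frechet_derivative_works by blast
  from frechet_derivative_at[OF this] show ?thesis by metis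
qed

lemma second_derivative_symmetric:
  fixes f :: "'a::euclidean_space \<Rightarrow> 'b::euclidean_space"
  assumes S: "open S" "x \<in> S" and f: "smooth_on S f"
  shows "frechet_derivative (\<lambda>y. frechet_derivative f (at y) u) (at x) v =
         frechet_derivative (\<lambda>y. frechet_derivative f (at y) v) (at x) u"
proof (rule euclidean_eqI)
  fix b :: 'b
  note L = bounded_linear_inner_left[of b]
  have fb: "smooth_on S (\<lambda>y. f y \<bullet> b)" by (rule smooth_on_linear_compose[OF L S(1) f])
  have "frechet_derivative (\<lambda>y. frechet_derivative f (at y) u) (at x) v \<bullet> b =
      frechet_derivative (\<lambda>y. frechet_derivative (\<lambda>z. f z \<bullet> b) (at y) u) (at x) v" for u v
  proof -
    have d: "(\<lambda>y. frechet_derivative f (at y) u) differentiable at x"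
      using smooth_on_differentiable[OF smooth_on_directional[OF f] S(2)] .
    have "frechet_derivative (\<lambda>y. frechet_derivative f (at y) u) (at x) v \<bullet> b =
      frechet_derivative (\<lambda>y. frechet_derivative f (at y) u \<bullet> b) (at x) v"
      using frechet_derivative_linear_compose[OF L d] by simp
    also have "frechet_derivative (\<lambda>y. frechet_derivative f (at y) u \<bullet> b) (at x) =
      frechet_derivative (\<lambda>y. frechet_derivative (\<lambda>z. f z \<bullet> b) (at y) u) (at x)"
    proof (rule frechet_derivative_transform_within_open[OF _ S])
      show "(\<lambda>y. frechet_derivative f (at y) u \<bullet> b) differentiable at x"
        using smooth_on_differentiable[OF smooth_on_linear_compose[OF L S(1) smooth_on_directional[OF f]] S(2)] .
      show "frechet_derivative f (at y) u \<bullet> b = frechet_derivative (\<lambda>z. f z \<bullet> b) (at y) u" if "y \<in> S" for y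
        using frechet_derivative_linear_compose[OF L smooth_on_differentiable[OF f that], of u] by simp
    qed
    finally show ?thesis .
  qed
  then show "frechet_derivative (\<lambda>y. frechet_derivative f (at y) u) (at x) v \<bullet> b =
        frechet_derivative (\<lambda>y. frechet_derivative f (at y) v) (at x) u \<bullet> b"
    using second_derivative_symmetric_real[OF S fb] by metis
qed

text \<open>Product rule for a derivative evaluated on a moving direction. Expansion in
  \<open>Basis\<close> reduces it to products of scalar and vector functions.\<close>

lemma has_derivative_frechet_derivative_apply:
  fixes f :: "'a::euclidean_space \<Rightarrow> 'b::real_normed_vector"
  assumes S: "open S" "x \<in> S" and f: "smooth_on S f" and w: "(w has_derivative w') (at x)"
  shows "((\<lambda>y. frechet_derivative f (at y) (w y)) has_derivative
    (\<lambda>u. frechet_derivative (\<lambda>y. frechet_derivative f (at y) (w x)) (at x) u +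
         frechet_derivative f (at x) (w' u))) (at x)"
proof -
  have lin: "linear (frechet_derivative f (at y))" if "y \<in> S" for y
    using smooth_on_differentiable[OF f that] by (rule linear_frechet_derivative)
  have D2: "((\<lambda>y. frechet_derivative f (at y) b) has_derivative
      frechet_derivative (\<lambda>y. frechet_derivative f (at y) b) (at x)) (at x)" for b
    by (rule smooth_on_has_derivative[OF smooth_on_directional[OF f] S(2)])
  have prod: "((\<lambda>y. frechet_derivative f (at y) (v y)) has_derivative
      (\<lambda>u. \<Sum>b\<in>Basis. (v x \<bullet> b) *\<^sub>R frechet_derivative (\<lambda>y. frechet_derivative f (at y) b) (at x) u +
          (v' u \<bullet> b) *\<^sub>R frechet_derivative f (at x) b)) (at x)"
    if "(v has_derivative v') (at x)" for v v'
  proof (rule has_derivative_transform_within_open[OF _ S])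
    show "((\<lambda>y. \<Sum>b\<in>Basis. (v y \<bullet> b) *\<^sub>R frechet_derivative f (at y) b) has_derivative
      (\<lambda>u. \<Sum>b\<in>Basis. (v x \<bullet> b) *\<^sub>R frechet_derivative (\<lambda>y. frechet_derivative f (at y) b) (at x) u +
          (v' u \<bullet> b) *\<^sub>R frechet_derivative f (at x) b)) (at x)"
      by (intro has_derivative_sum has_derivative_scaleR D2
          bounded_linear.has_derivative[OF bounded_linear_inner_left that])
    show "(\<Sum>b\<in>Basis. (v y \<bullet> b) *\<^sub>R frechet_derivative f (at y) b) = frechet_derivative f (at y) (v y)"
      if "y \<in> S" for y
      by (rule linear_eq_sum_Basis[OF lin[OF that], symmetric])
  qed
  \<comment> \<open>The rule for a constant direction identifies the first half of the sum as a
    second derivative.\<close>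
  have "frechet_derivative (\<lambda>y. frechet_derivative f (at y) (w x)) (at x) =
      (\<lambda>u. \<Sum>b\<in>Basis. (w x \<bullet> b) *\<^sub>R frechet_derivative (\<lambda>y. frechet_derivative f (at y) b) (at x) u)"
    using frechet_derivative_at[OF prod[OF has_derivative_const, of "w x"]] by simp
  moreover have "frechet_derivative f (at x) (w' u) = (\<Sum>b\<in>Basis. (w' u \<bullet> b) *\<^sub>R frechet_derivative f (at x) b)" for u
    by (rule linear_eq_sum_Basis[OF lin[OF S(2)]])
  ultimately show ?thesis
    using prod[OF w] by (simp add: sum.distrib)
qed

subsection \<open>Bump functions\<close>

text \<open>For \<open>m = 0\<close> this is the classical flat function
  \<open>exp (- 1 / t)\<close> extended by zero. The powers of \<open>1 / t\<close> make the family
  closed under differentiation up to linear combinations.\<close>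

definition flat_exp :: "nat \<Rightarrow> real \<Rightarrow> real"
  where "flat_exp m t = (if t \<le> 0 then 0 else exp (- inverse t) * inverse t ^ m)"

lemma flat_exp_pos: "t > 0 \<Longrightarrow> flat_exp m t > 0"
  by (simp add: flat_exp_def)

text \<open>With \<open>y = 1 / t\<close>, a single term of the exponential series bounds
  \<open>y ^ (m + 2)\<close>. Quadratic decay in \<open>t\<close> makes the difference quotient at 0
  tend to 0.\<close>

lemma flat_exp_bound: "\<bar>flat_exp m t\<bar> \<le> fact (m + 2) * t\<^sup>2"
proof (cases "t \<le> 0")
  case False
  define y where "y = inverse t"
  have y: "y > 0" "t = inverse y" using False by (simp_all add: y_def)
  have "(\<Sum>n\<in>{m + 2}. y ^ n /\<^sub>R fact n) \<le> exp y"
    unfolding exp_def using y(1) by (intro sum_le_suminf summable_exp_generic) auto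
  then have "inverse (fact (m + 2)) * (y ^ (m + 2)) \<le> exp y"
    by (simp del: fact_Suc)
  then have "y ^ (m + 2) \<le> fact (m + 2) * exp y"
    by (subst (asm) mult.commute, subst (asm) divide_inverse[symmetric], subst (asm) pos_divide_le_eq) (auto simp: mult.commute)
  then have "exp (- y) * y ^ (m + 2) \<le> exp (- y) * (fact (m + 2) * exp y)"
    by (intro mult_left_mono) auto
  also have "exp (- y) * (fact (m + 2) * exp y) = fact (m + 2)"
    by (simp add: mult.left_commute[of "exp (- y)"] del: fact_Suc flip: exp_add)
  finally have "exp (- y) * y ^ m * y\<^sup>2 \<le> fact (m + 2)"
    by (simp only: power_add mult.assoc)
  then have "exp (- y) * y ^ m \<le> fact (m + 2) * (inverse y)\<^sup>2"
    using y(1) by (simp add: power_inverse divide_inverse[symmetric] pos_le_divide_eq del: fact_Suc)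
  then show ?thesis using False y_def by (simp add: flat_exp_def del: fact_Suc)
qed (simp add: flat_exp_def)
lemma flat_exp_has_derivative:
  "(flat_exp m has_real_derivative (flat_exp (m + 2) t - real m * flat_exp (m + 1) t)) (at t)"
proof -
  consider "t < 0" | "t = 0" | "t > 0" by linarith
  then show ?thesis
  proof cases
    case 1
    have "((\<lambda>_. 0) has_real_derivative 0) (at t)" by simp
    then have "(flat_exp m has_real_derivative 0) (at t)"
      by (rule has_field_derivative_transform_within_open[of _ _ _ "{..<0}"]) (use 1 in \<open>auto simp: flat_exp_def\<close>)
    then show ?thesis using 1 by (simp add: flat_exp_def)
  next
    case 2
    have "((\<lambda>h. flat_exp m h / h) \<longlongrightarrow> 0) (at 0)"
    proof (rule Lim_null_comparison)
      show "eventually (\<lambda>h. norm (flat_exp m h / h) \<le> fact (m + 2) * \<bar>h\<bar>) (at 0)"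
      proof (intro always_eventually allI)
        fix h :: real
        show "norm (flat_exp m h / h) \<le> fact (m + 2) * \<bar>h\<bar>"
          using flat_exp_bound[of m h]
          by (cases "h = 0") (simp_all add: pos_divide_le_eq power2_eq_square abs_mult mult.assoc del: fact_Suc)
      qed
      show "((\<lambda>h::real. fact (m + 2) * \<bar>h\<bar>) \<longlongrightarrow> 0) (at 0)"
        by (auto intro!: tendsto_eq_intros)
    qed
    then have "(flat_exp m has_real_derivative 0) (at 0)"
      by (simp add: DERIV_def) (simp add: flat_exp_def)
    then show ?thesis using 2 by (simp add: flat_exp_def)
  next
    case 3
    have "((\<lambda>t. exp (- inverse t) * inverse t ^ m) has_real_derivative
        exp (- inverse t) * (inverse t)\<^sup>2 * inverse t ^ m -
        exp (- inverse t) * (real m * inverse t ^ (m - 1) * (inverse t)\<^sup>2)) (at t)"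
      using 3 by (auto intro!: derivative_eq_intros simp: power2_eq_square)
    \<comment> \<open>The exponent \<open>m - 1\<close> is truncated at \<open>m = 0\<close>, where
      the factor \<open>real m\<close> vanishes.\<close>
    also have "real m * inverse t ^ (m - 1) * (inverse t)\<^sup>2 = real m * inverse t ^ (m + 1)"
      by (cases m) (auto simp: power2_eq_square)
    finally have "((\<lambda>t. exp (- inverse t) * inverse t ^ m) has_real_derivative
        (flat_exp (m + 2) t - real m * flat_exp (m + 1) t)) (at t)"
      using 3 by (simp add: flat_exp_def power2_eq_square algebra_simps)
    then show ?thesis
      by (rule has_field_derivative_transform_within_open[of _ _ _ "{0<..}"]) (use 3 in \<open>auto simp: flat_exp_def\<close>)
  qed
qed

lemma k_smooth_on_flat_exp: "k_smooth_on k UNIV (flat_exp m)"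
proof (induction k arbitrary: m)
  case 0
  have "continuous_on UNIV (flat_exp m)"
    by (intro continuous_at_imp_continuous_on ballI DERIV_isCont[OF flat_exp_has_derivative])
  then show ?case by simp
next
  case (Suc k)
  show ?case
  proof (rule k_smooth_on_SucI)
    show "(flat_exp m has_derivative (\<lambda>v. (flat_exp (m + 2) t + (- real m) * flat_exp (m + 1) t) * v)) (at t)" for t
      using flat_exp_has_derivative[of m t] by (simp add: has_field_derivative_def)
    show "k_smooth_on k UNIV (\<lambda>t. (flat_exp (m + 2) t + (- real m) * flat_exp (m + 1) t) * v)" for v
      by (intro k_smooth_on_bilinear[OF bounded_bilinear_mult] k_smooth_on_add k_smooth_on_const
          Suc.IH open_UNIV)
  qed auto
qed

lemma smooth_bump:
  fixes x :: "'a::euclidean_space"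
  assumes "open S" "x \<in> S"
  obtains g :: "'a \<Rightarrow> real" and K where "compact K" "K \<subseteq> S" "smooth_on UNIV g" "g x = 1"
    "\<And>y. y \<notin> K \<Longrightarrow> g y = 0"
proof -
  obtain r where r: "r > 0" "cball x r \<subseteq> S" using assms open_contains_cball by blast
  \<comment> \<open>The argument of the numerator is positive exactly inside the ball of radius
    \<open>r\<close>; the denominator normalises the value at \<open>x\<close> to 1.\<close>
  define g where "g = (\<lambda>y. (1 / flat_exp 0 (r\<^sup>2)) *\<^sub>R flat_exp 0 (r\<^sup>2 - (y - x) \<bullet> (y - x)))"
  have "smooth_on UNIV (\<lambda>y. flat_exp 0 (r\<^sup>2 - (y - x) \<bullet> (y - x)))"
  proof (rule smooth_on_compose[of UNIV UNIV "\<lambda>y. r\<^sup>2 - (y - x) \<bullet> (y - x)" "flat_exp 0"])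
    show "smooth_on UNIV (flat_exp 0)"
      unfolding smooth_on_def using k_smooth_on_flat_exp by blast
    show "smooth_on UNIV (\<lambda>y. r\<^sup>2 - (y - x) \<bullet> (y - x))"
      by (intro smooth_on_diff smooth_on_inner smooth_on_ident smooth_on_const open_UNIV)
  qed auto
  then have "smooth_on UNIV g"
    unfolding g_def by (rule smooth_on_scaleR[OF open_UNIV smooth_on_const])
  moreover have "g x = 1" using flat_exp_pos[of "r\<^sup>2" 0] r by (simp add: g_def)
  moreover have "g y = 0" if "y \<notin> cball x r" for y
  proof -
    have "r \<le> norm (y - x)" using that by (simp add: dist_norm norm_minus_commute)
    then have "r\<^sup>2 \<le> (y - x) \<bullet> (y - x)"
      using r by (simp add: dot_square_norm)
    then show ?thesis by (simp add: g_def flat_exp_def)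
  qed
  ultimately show ?thesis using r(2) by (intro that[of "cball x r" g]) simp_all
qed

section \<open>Vector fields on a manifold\<close>

locale smooth_manifold =
  fixes A :: "('m::{t2_space, second_countable_topology}, 'k::finite) chart set"
  assumes atlas: "smooth_atlas A"
begin

section \<open>Charts and transition maps\<close>

lemma chart_at: "chart_at A p \<in> A" "p \<in> cdom (chart_at A p)"
proof -
  have "\<exists>c. c \<in> A \<and> p \<in> cdom c" using atlas unfolding smooth_atlas_def by blast
  from someI_ex[OF this] show "chart_at A p \<in> A" "p \<in> cdom (chart_at A p)"
    unfolding chart_at_def by auto
qed

lemma open_cdom: "c \<in> A \<Longrightarrow> open (cdom c)"
  and open_image_cdom: "c \<in> A \<Longrightarrow> open (cmap c ` cdom c)"
  and homeomorphism_chart: "c \<in> A \<Longrightarrow> homeomorphism (cdom c) (cmap c ` cdom c) (cmap c) (cinv c)"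
  using atlas unfolding smooth_atlas_def by auto

lemma cinv_cmap [simp]: "c \<in> A \<Longrightarrow> p \<in> cdom c \<Longrightarrow> cinv c (cmap c p) = p"
  using homeomorphism_chart homeomorphism_apply1 by blast

lemma continuous_on_cinv: "c \<in> A \<Longrightarrow> continuous_on (cmap c ` cdom c) (cinv c)"
  using homeomorphism_chart homeomorphism_cont2 by blast

lemma open_image_Int:
  assumes "c \<in> A" "open U"
  shows "open (cmap c ` (cdom c \<inter> U))"
proof -
  have "cmap c ` (cdom c \<inter> U) = cmap c ` cdom c \<inter> cinv c -` U"
    using assms(1) by auto
  then show ?thesis
    using continuous_open_preimage[OF continuous_on_cinv open_image_cdom] assms by simp
qed

lemma smooth_on_transition:
  assumes "c \<in> A" "d \<in> A"
  shows "smooth_on (cmap c ` (cdom c \<inter> cdom d)) (\<lambda>x. cmap d (cinv c x))"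
  using atlas assms unfolding smooth_atlas_def o_def by blast

lemma coord_change_has_derivative:
  assumes "c \<in> A" "d \<in> A" "p \<in> cdom c" "p \<in> cdom d"
  shows "((\<lambda>x. cmap d (cinv c x)) has_derivative coord_change c d p) (at (cmap c p))"
  unfolding coord_change_def o_def
  by (rule smooth_on_has_derivative[OF smooth_on_transition]) (use assms in auto)

lemma linear_coord_change:
  assumes "c \<in> A" "d \<in> A" "p \<in> cdom c" "p \<in> cdom d"
  shows "linear (coord_change c d p)"
  using has_derivative_linear[OF coord_change_has_derivative[OF assms]] .

text \<open>Chain rule for transition maps. The composite agrees with the direct transition on the
  image of the overlap of \<open>c\<close> and \<open>d\<close>, which is open and so determines the
  derivative.\<close>

lemma coord_change_trans:
  assumes "c \<in> A" "d \<in> A" "e \<in> A" "p \<in> cdom c" "p \<in> cdom d" "p \<in> cdom e"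
  shows "coord_change d e p (coord_change c d p v) = coord_change c e p v"
proof -
  have "((\<lambda>x. cmap e (cinv d (cmap d (cinv c x)))) has_derivative
      (\<lambda>v. coord_change d e p (coord_change c d p v))) (at (cmap c p))"
    by (rule has_derivative_compose[OF coord_change_has_derivative, where g = "\<lambda>y. cmap e (cinv d y)"])
      (use assms coord_change_has_derivative[of d e p] in auto)
  then have "((\<lambda>x. cmap e (cinv c x)) has_derivative
      (\<lambda>v. coord_change d e p (coord_change c d p v))) (at (cmap c p))"
    by (rule has_derivative_transform_within_open[OF _ open_image_Int[OF assms(1) open_cdom[OF assms(2)]]])
      (use assms in auto)
  from has_derivative_unique[OF this coord_change_has_derivative] show ?thesis
    using assms by metis
qed

lemma coord_change_same:
  assumes "c \<in> A" "p \<in> cdom c"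
  shows "coord_change c c p v = v"
proof -
  have "((\<lambda>x. x) has_derivative coord_change c c p) (at (cmap c p))"
    by (rule has_derivative_transform_within_open[OF coord_change_has_derivative
          open_image_cdom[OF assms(1)]]) (use assms in auto)
  from has_derivative_unique[OF this has_derivative_ident] show ?thesis by simp
qed

section \<open>Coordinate representatives of vector fields\<close>

lemma local_rep_cmap:
  "c \<in> A \<Longrightarrow> p \<in> cdom c \<Longrightarrow> local_rep A c X (cmap c p) = coord_change (chart_at A p) c p (X p)"
  by (simp add: local_rep_def)

lemma local_rep_chart_at: "local_rep A (chart_at A p) X (cmap (chart_at A p) p) = X p"
  by (simp add: local_rep_cmap chart_at coord_change_same)

lemma coord_change_local_rep:
  assumes "c \<in> A" "d \<in> A" "p \<in> cdom c" "p \<in> cdom d"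
  shows "coord_change c d p (local_rep A c X (cmap c p)) = local_rep A d X (cmap d p)"
  using assms by (simp add: local_rep_cmap coord_change_trans chart_at)

lemma smooth_vfieldD: "smooth_vfield A X \<Longrightarrow> c \<in> A \<Longrightarrow> smooth_on (cmap c ` cdom c) (local_rep A c X)"
  by (simp add: smooth_vfield_def)

text \<open>\<open>local_rep\<close> refers to an auxiliary chart that varies with the point. Here
  any smooth coordinate formula \<open>R\<close> that matches it on the chart domain may be used
  instead.\<close>

lemma smooth_vfieldI:
  assumes "\<And>c. c \<in> A \<Longrightarrow> smooth_on (cmap c ` cdom c) (R c)"
    and "\<And>c p. c \<in> A \<Longrightarrow> p \<in> cdom c \<Longrightarrow> coord_change (chart_at A p) c p (X p) = R c (cmap c p)"
  shows "smooth_vfield A X"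
  unfolding smooth_vfield_def
proof
  fix c assume c: "c \<in> A"
  show "smooth_on (cmap c ` cdom c) (local_rep A c X)"
  proof (rule smooth_on_cong[OF open_image_cdom[OF c] assms(1)[OF c]])
    show "R c x = local_rep A c X x" if "x \<in> cmap c ` cdom c" for x
      using that assms(2)[OF c] local_rep_cmap[OF c] by auto
  qed
qed

lemma linear_chart_at:
  "c \<in> A \<Longrightarrow> p \<in> cdom c \<Longrightarrow> linear (coord_change (chart_at A p) c p)"
  by (intro linear_coord_change chart_at)

lemma smooth_vfield_add:
  assumes "smooth_vfield A X" "smooth_vfield A Y"
  shows "smooth_vfield A (\<lambda>p. X p + Y p)"
  by (rule smooth_vfieldI[where R = "\<lambda>c x. local_rep A c X x + local_rep A c Y x"])
    (use assms in \<open>simp_all add: smooth_on_add open_image_cdom smooth_vfieldD local_rep_cmap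
      linear_add[OF linear_chart_at]\<close>)

lemma smooth_vfield_scaleR:
  assumes "smooth_fun A f" "smooth_vfield A X"
  shows "smooth_vfield A (\<lambda>p. f p *\<^sub>R X p)"
proof (rule smooth_vfieldI[where R = "\<lambda>c x. (f \<circ> cinv c) x *\<^sub>R local_rep A c X x"])
  fix c assume c: "c \<in> A"
  show "smooth_on (cmap c ` cdom c) (\<lambda>x. (f \<circ> cinv c) x *\<^sub>R local_rep A c X x)"
    using assms(1) c unfolding smooth_fun_def
    by (intro smooth_on_scaleR open_image_cdom smooth_vfieldD[OF assms(2)]) blast+
  show "coord_change (chart_at A p) c p (f p *\<^sub>R X p) =
      (f \<circ> cinv c) (cmap c p) *\<^sub>R local_rep A c X (cmap c p)" if "p \<in> cdom c" for p
    using c that by (simp add: local_rep_cmap linear_scale[OF linear_chart_at])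
qed

lemma smooth_fun_const: "smooth_fun A (\<lambda>p. r)"
  by (simp add: smooth_fun_def o_def)

lemmas smooth_vfield_scale = smooth_vfield_scaleR[OF smooth_fun_const]

lemma smooth_vfield_uminus: "smooth_vfield A X \<Longrightarrow> smooth_vfield A (\<lambda>p. - X p)"
  using smooth_vfield_scale[of X "-1"] by simp

lemma smooth_vfield_diff:
  "smooth_vfield A X \<Longrightarrow> smooth_vfield A Y \<Longrightarrow> smooth_vfield A (\<lambda>p. X p - Y p)"
  using smooth_vfield_add[of X "\<lambda>p. - Y p"] smooth_vfield_uminus[of Y] by simp

subsection \<open>Vector fields supported in a chart\<close>

text \<open>The support is compact, hence closed because the manifold is Hausdorff. Thus
  \<open>cdom d\<close> is covered by two open sets: the overlap with \<open>cdom c\<close>, and the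
  complement of the support, where \<open>F\<close> is zero.\<close>

lemma smooth_on_zero_extension:
  assumes "c \<in> A" "d \<in> A" "compact K" "K \<subseteq> cmap c ` cdom c"
    and "smooth_on (cmap d ` (cdom d \<inter> cdom c)) F"
    and "\<And>q. q \<in> cdom d \<Longrightarrow> q \<notin> cinv c ` K \<Longrightarrow> F (cmap d q) = 0"
  shows "smooth_on (cmap d ` cdom d) F"
proof -
  let ?U = "- (cinv c ` K)"
  have "compact (cinv c ` K)"
    using assms by (intro compact_continuous_image continuous_on_subset[OF continuous_on_cinv])
  then have U: "open ?U" by (simp add: compact_imp_closed open_Compl)
  have "cinv c ` K \<subseteq> cdom c" using assms(1,4) by force
  then have "cdom d = (cdom d \<inter> cdom c) \<union> (cdom d \<inter> ?U)" by blast
  then have eq: "cmap d ` cdom d = cmap d ` (cdom d \<inter> cdom c) \<union> cmap d ` (cdom d \<inter> ?U)"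
    by (metis image_Un)
  have "smooth_on (cmap d ` (cdom d \<inter> ?U)) F"
    by (rule smooth_on_cong[OF open_image_Int[OF assms(2) U] smooth_on_const]) (use assms(6) in auto)
  then show ?thesis
    unfolding eq using assms(1,2,5) U by (intro smooth_on_Un open_image_Int open_cdom)
qed

lemma transition_image:
  "c \<in> A \<Longrightarrow> d \<in> A \<Longrightarrow>
    (\<lambda>x. cmap c (cinv d x)) ` (cmap d ` (cdom d \<inter> cdom c)) \<subseteq> cmap c ` (cdom c \<inter> cdom d)"
  by auto

lemma smooth_fun_zero_extension:
  assumes c: "c \<in> A" and K: "compact K" "K \<subseteq> cmap c ` cdom c"
    and h: "smooth_on (cmap c ` cdom c) h" "\<And>y. y \<notin> K \<Longrightarrow> h y = 0"
  shows "smooth_fun A (\<lambda>q. if q \<in> cdom c then h (cmap c q) else 0)"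
  unfolding smooth_fun_def
proof
  fix d assume d: "d \<in> A"
  show "smooth_on (cmap d ` cdom d) ((\<lambda>q. if q \<in> cdom c then h (cmap c q) else 0) \<circ> cinv d)"
  proof (rule smooth_on_zero_extension[OF c d K])
    show "smooth_on (cmap d ` (cdom d \<inter> cdom c)) ((\<lambda>q. if q \<in> cdom c then h (cmap c q) else 0) \<circ> cinv d)"
    proof (rule smooth_on_cong[OF open_image_Int[OF d open_cdom[OF c]]])
      show "smooth_on (cmap d ` (cdom d \<inter> cdom c)) (\<lambda>x. h (cmap c (cinv d x)))"
        by (rule smooth_on_compose[OF open_image_Int[OF d open_cdom[OF c]] open_image_cdom[OF c] _ h(1)
              smooth_on_transition[OF d c]]) (use c d in auto)
    qed (use d in auto)
    show "((\<lambda>q. if q \<in> cdom c then h (cmap c q) else 0) \<circ> cinv d) (cmap d q) = 0"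
      if "q \<in> cdom d" "q \<notin> cinv c ` K" for q
    proof -
      have "cmap c q \<notin> K" if "q \<in> cdom c"
        using \<open>q \<notin> cinv c ` K\<close> c that by (metis cinv_cmap imageI)
      then show ?thesis using that d h(2) by auto
    qed
  qed
qed

lemma smooth_vfield_zero_extension:
  assumes c: "c \<in> A" and K: "compact K" "K \<subseteq> cmap c ` cdom c"
    and w: "smooth_on (cmap c ` cdom c) w" "\<And>y. y \<notin> K \<Longrightarrow> w y = 0"
  shows "smooth_vfield A (\<lambda>q. if q \<in> cdom c then coord_change c (chart_at A q) q (w (cmap c q)) else 0)"
    (is "smooth_vfield A ?X")
  unfolding smooth_vfield_def
proof
  fix d assume d: "d \<in> A"
  show "smooth_on (cmap d ` cdom d) (local_rep A d ?X)"
  proof (rule smooth_on_zero_extension[OF c d K])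
    let ?W = "cmap d ` (cdom d \<inter> cdom c)" and ?W' = "cmap c ` (cdom c \<inter> cdom d)"
    have W: "open ?W" "open ?W'" using c d by (auto intro: open_image_Int open_cdom)
    \<comment> \<open>The \<open>d\<close>-coordinates of the field: the push-forward of
      \<open>w\<close> by the transition map, still as a function of the
      \<open>c\<close>-coordinates.\<close>
    let ?u = "\<lambda>y. frechet_derivative (\<lambda>x. cmap d (cinv c x)) (at y) (w y)"
    have "smooth_on ?W' ?u"
      by (intro smooth_on_frechet_derivative_apply[OF W(2) smooth_on_transition[OF c d]]
          smooth_on_subset[OF w(1)]) auto
    from smooth_on_compose[OF W transition_image[OF c d] this smooth_on_transition[OF d c]]
    have "smooth_on ?W (\<lambda>x. ?u (cmap c (cinv d x)))" .
    then show "smooth_on ?W (local_rep A d ?X)"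
    proof (rule smooth_on_cong[OF W(1)])
      fix x assume "x \<in> ?W"
      then obtain q where q: "q \<in> cdom d" "q \<in> cdom c" "x = cmap d q" by auto
      then show "?u (cmap c (cinv d x)) = local_rep A d ?X x"
        using c d by (simp add: local_rep_cmap coord_change_trans chart_at)
          (simp add: coord_change_def o_def)
    qed
    show "local_rep A d ?X (cmap d q) = 0" if "q \<in> cdom d" "q \<notin> cinv c ` K" for q
    proof -
      have "cmap c q \<notin> K" if "q \<in> cdom c"
        using \<open>q \<notin> cinv c ` K\<close> c that by (metis cinv_cmap imageI)
      then have "?X q = 0"
        using w(2) c by (simp add: linear_0[OF linear_coord_change] chart_at)
      then show ?thesis
        using d that(1) by (simp add: local_rep_cmap linear_0[OF linear_chart_at])
    qed
  qed
qed

text \<open>Globalises functions and fields given only on a chart domain. The same \<open>g\<close>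
  works for all \<open>h\<close> and \<open>w\<close>, so products of such extensions can be
  compared.\<close>

lemma chart_bump:
  assumes c: "c \<in> A" and p: "p \<in> cdom c"
  obtains g where "g (cmap c p) = 1"
    "\<And>h. smooth_on (cmap c ` cdom c) h \<Longrightarrow>
      smooth_fun A (\<lambda>q. if q \<in> cdom c then g (cmap c q) * h (cmap c q) else 0)"
    "\<And>w. smooth_on (cmap c ` cdom c) w \<Longrightarrow>
      smooth_vfield A (\<lambda>q. if q \<in> cdom c
        then coord_change c (chart_at A q) q (g (cmap c q) *\<^sub>R w (cmap c q)) else 0)"
proof -
  let ?S = "cmap c ` cdom c"
  have "cmap c p \<in> ?S" using p by simp
  then obtain g :: "real ^ 'k \<Rightarrow> real" and K where K: "compact K" "K \<subseteq> ?S"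
    and g: "smooth_on UNIV g" "g (cmap c p) = 1" "\<And>y. y \<notin> K \<Longrightarrow> g y = 0"
    using smooth_bump[OF open_image_cdom[OF c]] by metis
  have gS: "smooth_on ?S g" using smooth_on_subset[OF g(1)] by simp
  show thesis
  proof (rule that[of g])
    show "smooth_fun A (\<lambda>q. if q \<in> cdom c then g (cmap c q) * h (cmap c q) else 0)"
      if "smooth_on ?S h" for h
      using smooth_fun_zero_extension[OF c K smooth_on_scaleR[OF open_image_cdom[OF c] gS that]] g(3)
      by (simp cong: if_cong)
    show "smooth_vfield A (\<lambda>q. if q \<in> cdom c
        then coord_change c (chart_at A q) q (g (cmap c q) *\<^sub>R w (cmap c q)) else 0)"
      if "smooth_on ?S w" for w
      using smooth_vfield_zero_extension[OF c K smooth_on_scaleR[OF open_image_cdom[OF c] gS that]] g(3)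
      by simp
  qed (fact g(2))
qed

lemma smooth_vfield_extension: "\<exists>V. smooth_vfield A V \<and> V p = v"
proof -
  let ?c = "chart_at A p"
  obtain g where g: "g (cmap ?c p) = 1" and "\<And>h. smooth_on (cmap ?c ` cdom ?c) h \<Longrightarrow>
      smooth_fun A (\<lambda>q. if q \<in> cdom ?c then g (cmap ?c q) * h (cmap ?c q) else 0)"
    and "\<And>w. smooth_on (cmap ?c ` cdom ?c) w \<Longrightarrow>
      smooth_vfield A (\<lambda>q. if q \<in> cdom ?c
        then coord_change ?c (chart_at A q) q (g (cmap ?c q) *\<^sub>R w (cmap ?c q)) else 0)"
    by (rule chart_bump[OF chart_at[of p]]) blast
  from this(3)[OF smooth_on_const[of _ v]] g show ?thesis
    by (intro exI conjI) (assumption, simp add: chart_at coord_change_same)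
qed

section \<open>Tensoriality at a point\<close>

definition tensorial_at :: "'m \<Rightarrow> (('m, 'k) vfield \<Rightarrow> 'v::real_vector) \<Rightarrow> bool"
  where "tensorial_at p G \<longleftrightarrow>
    (\<forall>X Y. smooth_vfield A X \<longrightarrow> smooth_vfield A Y \<longrightarrow> G (\<lambda>q. X q + Y q) = G X + G Y) \<and>
    (\<forall>f X. smooth_fun A f \<longrightarrow> smooth_vfield A X \<longrightarrow> G (\<lambda>q. f q *\<^sub>R X q) = f p *\<^sub>R G X)"

lemma tensorial_at_add:
  "tensorial_at p G \<Longrightarrow> smooth_vfield A X \<Longrightarrow> smooth_vfield A Y \<Longrightarrow> G (\<lambda>q. X q + Y q) = G X + G Y"
  and tensorial_at_scaleR:
  "tensorial_at p G \<Longrightarrow> smooth_fun A f \<Longrightarrow> smooth_vfield A X \<Longrightarrow> G (\<lambda>q. f q *\<^sub>R X q) = f p *\<^sub>R G X"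
  by (auto simp: tensorial_at_def)

lemma tensorial_at_zero:
  assumes "tensorial_at p G" shows "G (\<lambda>q. 0) = 0"
proof -
  obtain V :: "('m, 'k) vfield" where "smooth_vfield A V" using smooth_vfield_extension by blast
  then show ?thesis
    using tensorial_at_scaleR[OF assms smooth_fun_const[of 0]] by simp
qed

lemma smooth_vfield_zero: "smooth_vfield A (\<lambda>q. 0)"
proof -
  obtain V :: "('m, 'k) vfield" where "smooth_vfield A V" using smooth_vfield_extension by blast
  then show ?thesis using smooth_vfield_scale[of V 0] by simp
qed

lemma tensorial_at_sum:
  assumes "tensorial_at p G" "finite I" "\<And>i. i \<in> I \<Longrightarrow> smooth_vfield A (Z i)"
  shows "smooth_vfield A (\<lambda>q. \<Sum>i\<in>I. Z i q) \<and> G (\<lambda>q. \<Sum>i\<in>I. Z i q) = (\<Sum>i\<in>I. G (Z i))"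
  using assms(2,3)
proof (induction I rule: finite_induct)
  case empty
  then show ?case using tensorial_at_zero[OF assms(1)] smooth_vfield_zero by simp
next
  case (insert i I)
  then show ?case
    using smooth_vfield_add tensorial_at_add[OF assms(1)] by simp
qed

text \<open>With a bump function \<open>\<beta>\<close> and the coordinate fields \<open>e\<^sub>b\<close>, the field \<open>\<beta>\<^sup>2 V\<close> is the
  globally defined sum of the \<open>(\<beta> V\<^sup>b) (\<beta> e\<^sub>b)\<close>.\<close>

lemma tensorial_at_eq_zero:
  assumes G: "tensorial_at p G" and V: "smooth_vfield A V" "V p = 0"
  shows "G V = 0"
proof -
  let ?c = "chart_at A p"
  note c = chart_at[of p]
  obtain g where g: "g (cmap ?c p) = 1"
    and fe: "\<And>h. smooth_on (cmap ?c ` cdom ?c) h \<Longrightarrow>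
      smooth_fun A (\<lambda>q. if q \<in> cdom ?c then g (cmap ?c q) * h (cmap ?c q) else 0)"
    and ve: "\<And>w. smooth_on (cmap ?c ` cdom ?c) w \<Longrightarrow>
      smooth_vfield A (\<lambda>q. if q \<in> cdom ?c
        then coord_change ?c (chart_at A q) q (g (cmap ?c q) *\<^sub>R w (cmap ?c q)) else 0)"
    by (rule chart_bump[OF c]) blast
  define \<beta> where "\<beta> q = (if q \<in> cdom ?c then g (cmap ?c q) else 0)" for q
  define f where "f b q = (if q \<in> cdom ?c then g (cmap ?c q) * (local_rep A ?c V (cmap ?c q) \<bullet> b) else 0)" for b q
  define E where "E b q = (if q \<in> cdom ?c then coord_change ?c (chart_at A q) q (g (cmap ?c q) *\<^sub>R b) else 0)" for b q
  have \<beta>: "smooth_fun A \<beta>" "\<beta> p = 1"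
    using fe[of "\<lambda>_. 1"] g c by (simp_all add: \<beta>_def[abs_def] cong: if_cong)
  have f: "smooth_fun A (f b)" for b
    unfolding f_def
    by (rule fe[of "\<lambda>y. local_rep A ?c V y \<bullet> b"])
      (intro smooth_on_inner open_image_cdom smooth_vfieldD V c smooth_on_const)
  have fp: "f b p = 0" for b
    using V(2) by (simp add: f_def local_rep_chart_at)
  have E: "smooth_vfield A (E b)" for b
    unfolding E_def using ve[of "\<lambda>_. b"] by simp
  have "\<beta> q *\<^sub>R \<beta> q *\<^sub>R V q = (\<Sum>b\<in>Basis. f b q *\<^sub>R E b q)" for q
  proof (cases "q \<in> cdom ?c")
    case True
    let ?L = "coord_change ?c (chart_at A q) q" and ?v = "local_rep A ?c V (cmap ?c q)"
    have lin: "linear ?L" using True c by (intro linear_coord_change chart_at)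
    have "V q = ?L ?v"
      using coord_change_local_rep[OF c(1) chart_at(1) True chart_at(2)] by (simp add: local_rep_chart_at)
    also have "\<dots> = (\<Sum>b\<in>Basis. (?v \<bullet> b) *\<^sub>R ?L b)" by (rule linear_eq_sum_Basis[OF lin])
    finally have "V q = (\<Sum>b\<in>Basis. (?v \<bullet> b) *\<^sub>R ?L b)" .
    then have "\<beta> q *\<^sub>R \<beta> q *\<^sub>R V q = (\<Sum>b\<in>Basis. \<beta> q *\<^sub>R \<beta> q *\<^sub>R (?v \<bullet> b) *\<^sub>R ?L b)"
      by (simp only: scaleR_sum_right)
    also have "\<dots> = (\<Sum>b\<in>Basis. f b q *\<^sub>R E b q)"
      using True by (intro sum.cong refl) (simp add: \<beta>_def f_def E_def linear_scale[OF lin] mult.left_commute)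
    finally show ?thesis .
  qed (simp add: \<beta>_def f_def)
  then have eq: "(\<lambda>q. \<beta> q *\<^sub>R \<beta> q *\<^sub>R V q) = (\<lambda>q. \<Sum>b\<in>Basis. f b q *\<^sub>R E b q)" by blast
  \<comment> \<open>Multiplication by the bump function alters \<open>V\<close> away from
    \<open>p\<close> but not \<open>G V\<close>, as the function is 1 at \<open>p\<close>.\<close>
  have "G V = G (\<lambda>q. \<beta> q *\<^sub>R \<beta> q *\<^sub>R V q)"
    using \<beta> V(1) by (simp add: tensorial_at_scaleR[OF G] smooth_vfield_scaleR del: scaleR_scaleR)
  also have "\<dots> = (\<Sum>b\<in>Basis. G (\<lambda>q. f b q *\<^sub>R E b q))"
    unfolding eq by (rule tensorial_at_sum[OF G, THEN conjunct2]) (auto intro: smooth_vfield_scaleR f E)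
  also have "\<dots> = 0"
    by (simp add: tensorial_at_scaleR[OF G f E] fp)
  finally show ?thesis .
qed

lemma tensorial_at_cong:
  assumes G: "tensorial_at p G" and "smooth_vfield A X" "smooth_vfield A Y" "X p = Y p"
  shows "G X = G Y"
proof -
  have s: "smooth_vfield A (\<lambda>q. X q - Y q)" using assms by (simp add: smooth_vfield_diff)
  have "G X = G (\<lambda>q. (X q - Y q) + Y q)" by simp
  also have "\<dots> = G (\<lambda>q. X q - Y q) + G Y" using tensorial_at_add[OF G s assms(3)] .
  also have "G (\<lambda>q. X q - Y q) = 0" using tensorial_at_eq_zero[OF G s] assms(4) by simp
  finally show ?thesis by simp
qed

subsection \<open>The Lie bracket\<close>

lemma local_rep_has_derivative:
  assumes "smooth_vfield A X" "c \<in> A" "p \<in> cdom c"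
  shows "(local_rep A c X has_derivative frechet_derivative (local_rep A c X) (at (cmap c p))) (at (cmap c p))"
  using smooth_on_has_derivative[OF smooth_vfieldD[OF assms(1,2)]] assms(3) by blast

text \<open>Differentiate the transformation law, which writes the \<open>d\<close>-coordinates of
  \<open>X\<close> as the derivative of the transition map applied to its
  \<open>c\<close>-coordinates. The first summand is the non-tensorial term, a second derivative of
  the transition map.\<close>

lemma local_rep_derivative_change:
  assumes X: "smooth_vfield A X" and cd: "c \<in> A" "d \<in> A" and p: "p \<in> cdom c" "p \<in> cdom d"
  shows "frechet_derivative (local_rep A d X) (at (cmap d p)) (coord_change c d p u) =
    frechet_derivative (\<lambda>y. frechet_derivative (\<lambda>x. cmap d (cinv c x)) (at y)
      (local_rep A c X (cmap c p))) (at (cmap c p)) u +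
    coord_change c d p (frechet_derivative (local_rep A c X) (at (cmap c p)) u)"
proof -
  let ?W = "cmap c ` (cdom c \<inter> cdom d)" and ?\<phi> = "\<lambda>x. cmap d (cinv c x)"
  have W: "open ?W" "cmap c p \<in> ?W" using cd p open_image_Int open_cdom by auto
  have d1: "((\<lambda>y. frechet_derivative ?\<phi> (at y) (local_rep A c X y)) has_derivative
     (\<lambda>u. frechet_derivative (\<lambda>y. frechet_derivative ?\<phi> (at y) (local_rep A c X (cmap c p))) (at (cmap c p)) u +
      frechet_derivative ?\<phi> (at (cmap c p)) (frechet_derivative (local_rep A c X) (at (cmap c p)) u))) (at (cmap c p))"
    by (rule has_derivative_frechet_derivative_apply[OF W smooth_on_transition[OF cd]
          local_rep_has_derivative[OF X cd(1) p(1)]])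
  have eq: "frechet_derivative ?\<phi> (at y) (local_rep A c X y) = local_rep A d X (?\<phi> y)" if "y \<in> ?W" for y
    using that coord_change_local_rep[OF cd, symmetric] cd by (auto simp: coord_change_def o_def)
  have d2: "((\<lambda>y. local_rep A d X (?\<phi> y)) has_derivative
     (\<lambda>u. frechet_derivative (local_rep A d X) (at (cmap d p)) (coord_change c d p u))) (at (cmap c p))"
    by (rule has_derivative_compose[OF coord_change_has_derivative[OF cd p], where g = "local_rep A d X"])
      (use local_rep_has_derivative[OF X cd(2) p(2)] cd p in simp)
  from fun_cong[OF has_derivative_unique[OF d2 has_derivative_transform_within_open[OF d1 W eq]], of u]
  show ?thesis by (simp add: coord_change_def o_def)
qed

text \<open>Chart independence of the bracket: the second derivatives of the transition map are
  symmetric in \<open>X p\<close> and \<open>Y p\<close> and cancel in the difference.\<close>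

lemma coord_change_lie_bracket:
  assumes X: "smooth_vfield A X" and Y: "smooth_vfield A Y" and c: "c \<in> A" "p \<in> cdom c"
  shows "coord_change (chart_at A p) c p (lie_bracket A X Y p) =
    frechet_derivative (local_rep A c Y) (at (cmap c p)) (local_rep A c X (cmap c p)) -
    frechet_derivative (local_rep A c X) (at (cmap c p)) (local_rep A c Y (cmap c p))"
proof -
  let ?b = "chart_at A p" let ?W = "cmap ?b ` (cdom ?b \<inter> cdom c)"
  note b = chart_at[of p]
  have W: "open ?W" "cmap ?b p \<in> ?W" using b c open_image_Int open_cdom by auto
  have X': "local_rep A c X (cmap c p) = coord_change ?b c p (X p)"
    and Y': "local_rep A c Y (cmap c p) = coord_change ?b c p (Y p)"
    using c by (simp_all add: local_rep_cmap)
  show ?thesis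
    unfolding X' Y' local_rep_derivative_change[OF X b(1) c(1) b(2) c(2)]
      local_rep_derivative_change[OF Y b(1) c(1) b(2) c(2)] local_rep_chart_at
      second_derivative_symmetric[OF W smooth_on_transition[OF b(1) c(1)], of "X p" "Y p"]
    by (simp add: lie_bracket_def Let_def linear_diff[OF linear_chart_at[OF c]])
qed

text \<open>The definition uses a different chart at each point; the preceding formula expresses the
  bracket throughout one fixed chart, where smoothness is visible.\<close>

lemma smooth_vfield_lie_bracket:
  assumes "smooth_vfield A X" "smooth_vfield A Y"
  shows "smooth_vfield A (lie_bracket A X Y)"
  by (rule smooth_vfieldI[OF _ coord_change_lie_bracket[OF assms]])
    (intro smooth_on_diff smooth_on_frechet_derivative_apply open_image_cdom smooth_vfieldD assms)

section \<open>Additivity and Leibniz rule of the bracket\<close>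

lemma local_rep_chart_at_derivative:
  assumes "smooth_vfield A X"
  shows "(local_rep A (chart_at A p) X has_derivative
    frechet_derivative (local_rep A (chart_at A p) X) (at (cmap (chart_at A p) p))) (at (cmap (chart_at A p) p))"
  by (rule local_rep_has_derivative[OF assms chart_at])

lemma frechet_derivative_local_rep_add:
  assumes "smooth_vfield A X" "smooth_vfield A Y"
  shows "frechet_derivative (local_rep A (chart_at A p) (\<lambda>q. X q + Y q)) (at (cmap (chart_at A p) p)) v =
    frechet_derivative (local_rep A (chart_at A p) X) (at (cmap (chart_at A p) p)) v +
    frechet_derivative (local_rep A (chart_at A p) Y) (at (cmap (chart_at A p) p)) v"
proof -
  let ?c = "chart_at A p"
  have "(local_rep A ?c (\<lambda>q. X q + Y q) has_derivative
     (\<lambda>v. frechet_derivative (local_rep A ?c X) (at (cmap ?c p)) v +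
          frechet_derivative (local_rep A ?c Y) (at (cmap ?c p)) v)) (at (cmap ?c p))"
    by (rule has_derivative_transform_within_open[OF has_derivative_add[OF
            local_rep_chart_at_derivative[OF assms(1)] local_rep_chart_at_derivative[OF assms(2)]]
          open_image_cdom[OF chart_at(1)]])
      (auto simp: chart_at local_rep_cmap linear_add[OF linear_chart_at])
  from frechet_derivative_at[OF this, symmetric] show ?thesis by simp
qed

lemma frechet_derivative_local_rep_scaleR:
  assumes f: "smooth_fun A f" and X: "smooth_vfield A X"
  shows "frechet_derivative (local_rep A (chart_at A p) (\<lambda>q. f q *\<^sub>R X q)) (at (cmap (chart_at A p) p)) v =
    f p *\<^sub>R frechet_derivative (local_rep A (chart_at A p) X) (at (cmap (chart_at A p) p)) v +
    frechet_derivative (f \<circ> cinv (chart_at A p)) (at (cmap (chart_at A p) p)) v *\<^sub>R X p"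
proof -
  let ?c = "chart_at A p"
  have df: "(f \<circ> cinv ?c has_derivative frechet_derivative (f \<circ> cinv ?c) (at (cmap ?c p))) (at (cmap ?c p))"
    by (rule smooth_on_has_derivative[where S = "cmap ?c ` cdom ?c"])
      (use f chart_at[of p] in \<open>auto simp: smooth_fun_def\<close>)
  have "(local_rep A ?c (\<lambda>q. f q *\<^sub>R X q) has_derivative
     (\<lambda>v. (f \<circ> cinv ?c) (cmap ?c p) *\<^sub>R frechet_derivative (local_rep A ?c X) (at (cmap ?c p)) v +
          frechet_derivative (f \<circ> cinv ?c) (at (cmap ?c p)) v *\<^sub>R local_rep A ?c X (cmap ?c p))) (at (cmap ?c p))"
    by (rule has_derivative_transform_within_open[OF has_derivative_scaleR[OF
            df local_rep_chart_at_derivative[OF X]] open_image_cdom[OF chart_at(1)]])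
      (auto simp: chart_at local_rep_cmap linear_scale[OF linear_chart_at])
  from frechet_derivative_at[OF this, symmetric] show ?thesis
    by (simp add: local_rep_chart_at chart_at)
qed

lemma linear_frechet_derivative_local_rep:
  "smooth_vfield A X \<Longrightarrow>
    linear (frechet_derivative (local_rep A (chart_at A p) X) (at (cmap (chart_at A p) p)))"
  using has_derivative_linear[OF local_rep_chart_at_derivative] .

lemma lie_bracket_skew: "lie_bracket A X Y p = - lie_bracket A Y X p"
  by (simp add: lie_bracket_def Let_def)

lemma lie_bracket_add:
  assumes "smooth_vfield A X" "smooth_vfield A Y" "smooth_vfield A Z"
  shows "lie_bracket A X (\<lambda>q. Y q + Z q) p = lie_bracket A X Y p + lie_bracket A X Z p"
  using assms by (simp add: lie_bracket_def Let_def frechet_derivative_local_rep_add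
      linear_add[OF linear_frechet_derivative_local_rep])

lemma lie_bracket_scaleR:
  assumes "smooth_fun A f" "smooth_vfield A X" "smooth_vfield A Y"
  shows "lie_bracket A X (\<lambda>q. f q *\<^sub>R Y q) p = f p *\<^sub>R lie_bracket A X Y p + dir_deriv A X f p *\<^sub>R Y p"
  using assms by (simp add: lie_bracket_def dir_deriv_def Let_def frechet_derivative_local_rep_scaleR
      linear_scale[OF linear_frechet_derivative_local_rep] algebra_simps)

end

section \<open>Linear algebra of a complex structure\<close>

lemma mem_span_pair: "x \<in> span {u, v} \<longleftrightarrow> (\<exists>a b. x = a *\<^sub>R u + b *\<^sub>R v)"
proof
  assume "x \<in> span {u, v}"
  then obtain a where "x - a *\<^sub>R u \<in> span {v}" using span_breakdown_eq by blast
  then obtain b where "x - a *\<^sub>R u = b *\<^sub>R v" by (auto simp: span_singleton)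
  then have "x = a *\<^sub>R u + b *\<^sub>R v" by (simp add: algebra_simps)
  then show "\<exists>a b. x = a *\<^sub>R u + b *\<^sub>R v" by blast
next
  assume "\<exists>a b. x = a *\<^sub>R u + b *\<^sub>R v"
  then obtain a b where "x = a *\<^sub>R u + b *\<^sub>R v" by blast
  moreover have "a *\<^sub>R u + b *\<^sub>R v \<in> span {u, v}"
    by (intro span_add span_scale span_base) simp_all
  ultimately show "x \<in> span {u, v}" by simp
qed

lemma scaleR_mult_2: "(r * 2) *\<^sub>R x = r *\<^sub>R x + r *\<^sub>R (x::'a::real_vector)"
  by (metis mult_2_right scaleR_add_left)

locale complex_structure =
  fixes I :: "'a::real_vector \<Rightarrow> 'a"
  assumes linear_I: "linear I" and I_I [simp]: "I (I v) = - v"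
begin

lemmas I_simps = linear_add[OF linear_I] linear_diff[OF linear_I] linear_neg[OF linear_I]
  linear_scale[OF linear_I] linear_0[OF linear_I]

text \<open>Multiplication by the conjugate of the complex scalar with real part \<open>a\<close>
  and imaginary part \<open>b\<close>.\<close>

lemma complex_inverse:
  assumes "a *\<^sub>R v + b *\<^sub>R I v = u"
  shows "(a * a + b * b) *\<^sub>R v = a *\<^sub>R u - b *\<^sub>R I u"
  unfolding assms[symmetric] by (simp add: I_simps algebra_simps)

text \<open>Complex independence of \<open>v\<close> and \<open>w\<close> in real coefficients: a
  nonzero complex coefficient of \<open>w\<close> could be inverted, which would put
  \<open>w\<close> on the complex line of \<open>v\<close>.\<close>

lemma complex_independent:
  assumes w: "\<And>s t. w \<noteq> s *\<^sub>R v + t *\<^sub>R I v" and v: "v \<noteq> 0"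
    and eq: "s *\<^sub>R v + t *\<^sub>R I v = x *\<^sub>R w + y *\<^sub>R I w"
  shows "s = 0 \<and> t = 0 \<and> x = 0 \<and> y = 0"
proof -
  have xy: "x = 0 \<and> y = 0"
  proof (rule ccontr)
    assume "\<not> ?thesis"
    then have c: "x * x + y * y \<noteq> 0" by (simp add: sum_squares_eq_zero_iff)
    let ?c = "inverse (x * x + y * y)"
    have "w = ?c *\<^sub>R (x * x + y * y) *\<^sub>R w" using c by simp
    also have "\<dots> = ?c *\<^sub>R (x *\<^sub>R (s *\<^sub>R v + t *\<^sub>R I v) - y *\<^sub>R I (s *\<^sub>R v + t *\<^sub>R I v))"
      using complex_inverse[OF eq[symmetric]] by simp
    also have "\<dots> = (?c * (x * s + y * t)) *\<^sub>R v + (?c * (x * t - y * s)) *\<^sub>R I v"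
      by (simp add: I_simps algebra_simps)
    finally show False using w by blast
  qed
  then have "s *\<^sub>R v + t *\<^sub>R I v = 0" using eq by simp
  from complex_inverse[OF this] have "(s * s + t * t) *\<^sub>R v = 0" by (simp add: I_simps)
  then have "s = 0 \<and> t = 0" using v by (simp add: sum_squares_eq_zero_iff)
  with xy show ?thesis by blast
qed

text \<open>For sesquilinear \<open>Q\<close>, polarisation at \<open>v, w\<close> yields \<open>Q v w + Q w v\<close> and
  polarisation at \<open>v, I w\<close> yields \<open>Q v w - Q w v\<close>.\<close>

lemma polarise_diagonal:
  assumes Q: "\<And>v. linear (Q v)" "\<And>w. linear (\<lambda>v. Q v w)"
    and diag: "\<And>u. Q u u \<in> span {u, I u}"
    and w: "\<And>s t. w \<noteq> s *\<^sub>R v + t *\<^sub>R I v" and v: "v \<noteq> 0"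
    and Qv: "Q v v = a *\<^sub>R v + b *\<^sub>R I v" and Qw: "Q w w = c *\<^sub>R w + d *\<^sub>R I w"
  shows "Q v w + Q w v = (c *\<^sub>R v + d *\<^sub>R I v) + (a *\<^sub>R w + b *\<^sub>R I w)"
proof -
  note Q_simps = linear_add[OF Q(1)] linear_diff[OF Q(1)] linear_add[OF Q(2)] linear_diff[OF Q(2)]
  obtain a1 b1 where p: "Q (v + w) (v + w) = a1 *\<^sub>R (v + w) + b1 *\<^sub>R I (v + w)"
    using diag mem_span_pair by meson
  obtain a2 b2 where m: "Q (v - w) (v - w) = a2 *\<^sub>R (v - w) + b2 *\<^sub>R I (v - w)"
    using diag mem_span_pair by meson
  have p': "Q v v + Q v w + (Q w v + Q w w) = a1 *\<^sub>R (v + w) + b1 *\<^sub>R I (v + w)"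
    using p by (simp add: Q_simps algebra_simps)
  have m': "Q v v - Q v w - (Q w v - Q w w) = a2 *\<^sub>R (v - w) + b2 *\<^sub>R I (v - w)"
    using m by (simp add: Q_simps algebra_simps)
  \<comment> \<open>Parallelogram identity: adding the expansions at \<open>v + w\<close> and
    \<open>v - w\<close> removes the mixed terms, and independence then determines the four unknown
    coefficients.\<close>
  have "(a + a - a1 - a2) *\<^sub>R v + (b + b - b1 - b2) *\<^sub>R I v -
      ((a1 - a2 - c - c) *\<^sub>R w + (b1 - b2 - d - d) *\<^sub>R I w) =
      (Q v v + Q w w) + (Q v v + Q w w) -
      ((Q v v + Q v w + (Q w v + Q w w)) + (Q v v - Q v w - (Q w v - Q w w)))"
    unfolding p' m' unfolding Qv Qw by (simp add: I_simps algebra_simps scaleR_mult_2)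
  then have "(a + a - a1 - a2) *\<^sub>R v + (b + b - b1 - b2) *\<^sub>R I v =
      (a1 - a2 - c - c) *\<^sub>R w + (b1 - b2 - d - d) *\<^sub>R I w"
    by simp
  from complex_independent[OF w v this]
  have e: "a1 = a + c" "a2 = a - c" "b1 = b + d" "b2 = b - d" by auto
  have "Q v w + Q w v = (Q v v + Q v w + (Q w v + Q w w)) - Q v v - Q w w" by simp
  also have "\<dots> = (c *\<^sub>R v + d *\<^sub>R I v) + (a *\<^sub>R w + b *\<^sub>R I w)"
    unfolding p' unfolding Qv Qw e by (simp add: I_simps algebra_simps)
  finally show ?thesis .
qed

text \<open>The scalar is read off from \<open>Q v v\<close>. On the complex line of
  \<open>v\<close> linearity in the second argument suffices; off that line the two polarisations
  are added.\<close>

lemma sesquilinear_diagonal: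
  assumes Q: "\<And>v. linear (Q v)" "\<And>w. linear (\<lambda>v. Q v w)"
    and anti: "\<And>v w. Q (I v) w = - I (Q v w)" and lin: "\<And>v w. Q v (I w) = I (Q v w)"
    and diag: "\<And>u. Q u u \<in> span {u, I u}"
  shows "\<exists>a b. \<forall>w. Q v w = a *\<^sub>R w + b *\<^sub>R I w"
proof (cases "v = 0")
  case True
  then show ?thesis using linear_0[OF Q(2)] by (intro exI[of _ 0]) simp
next
  case False
  obtain a b where Qv: "Q v v = a *\<^sub>R v + b *\<^sub>R I v" using diag mem_span_pair by meson
  have "Q v w = a *\<^sub>R w + b *\<^sub>R I w" for w
  proof (cases "\<exists>s t. w = s *\<^sub>R v + t *\<^sub>R I v")
    case True
    then obtain s t where "w = s *\<^sub>R v + t *\<^sub>R I v" by blast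
    then show ?thesis
      by (simp add: linear_add[OF Q(1)] linear_scale[OF Q(1)] lin Qv I_simps algebra_simps)
  next
    case False
    then have w: "w \<noteq> s *\<^sub>R v + t *\<^sub>R I v" for s t by blast
    have Iw: "I w \<noteq> s *\<^sub>R v + t *\<^sub>R I v" for s t
    proof
      assume "I w = s *\<^sub>R v + t *\<^sub>R I v"
      then have "- I (I w) = t *\<^sub>R v + (- s) *\<^sub>R I v" by (simp add: I_simps)
      then show False using w[of t "- s"] by simp
    qed
    obtain c d where Qw: "Q w w = c *\<^sub>R w + d *\<^sub>R I w" using diag mem_span_pair by meson
    \<comment> \<open>\<open>Q\<close> takes the same value at \<open>(w, w)\<close> and
      \<open>(I w, I w)\<close>; relative to \<open>I w\<close> and \<open>I (I w)\<close> its
      coefficients become \<open>d\<close> and \<open>- c\<close>.\<close>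
    have QIw: "Q (I w) (I w) = d *\<^sub>R I w + (- c) *\<^sub>R I (I w)"
      by (simp add: anti lin Qw I_simps)
    have s: "Q v w + Q w v = (c *\<^sub>R v + d *\<^sub>R I v) + (a *\<^sub>R w + b *\<^sub>R I w)"
      by (rule polarise_diagonal[OF Q diag w \<open>v \<noteq> 0\<close> Qv Qw])
    have "Q v (I w) + Q (I w) v = (d *\<^sub>R v + (- c) *\<^sub>R I v) + (a *\<^sub>R I w + b *\<^sub>R I (I w))"
      by (rule polarise_diagonal[OF Q diag Iw \<open>v \<noteq> 0\<close> Qv QIw])
    then have "I (Q v w - Q w v) = (d *\<^sub>R v + (- c) *\<^sub>R I v) + (a *\<^sub>R I w + b *\<^sub>R I (I w))"
      by (simp add: lin anti I_simps)
    then have "- I (I (Q v w - Q w v)) = - I ((d *\<^sub>R v + (- c) *\<^sub>R I v) + (a *\<^sub>R I w + b *\<^sub>R I (I w)))"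
      by (rule arg_cong)
    then have m: "Q v w - Q w v = (- c *\<^sub>R v - d *\<^sub>R I v) + (a *\<^sub>R w + b *\<^sub>R I w)"
      by (simp add: I_simps)
    have "2 *\<^sub>R Q v w = (Q v w + Q w v) + (Q v w - Q w v)" by (simp add: scaleR_2)
    also have "\<dots> = 2 *\<^sub>R (a *\<^sub>R w + b *\<^sub>R I w)"
      unfolding s m by (simp add: algebra_simps scaleR_2 scaleR_mult_2)
    finally show ?thesis by simp
  qed
  then show ?thesis by blast
qed

end

section \<open>Traces and complex structures\<close>

lemma trace_matrix: "trace (matrix f) = (\<Sum>i\<in>UNIV. f (axis i 1) $ i)"
  by (simp add: trace_def matrix_def)

text \<open>With respect to the inner product with Gram matrix \<open>1 + I\<^sup>T I\<close> the structure \<open>I\<close>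
  is orthogonal, hence skew.\<close>

lemma trace_complex_structure:
  fixes I :: "real ^ 'n \<Rightarrow> real ^ 'n"
  assumes "complex_structure I"
  shows "trace (matrix I) = 0"
proof -
  interpret complex_structure I by fact
  define M where "M = matrix I"
  have Mv: "M *v x = I x" for x by (simp add: M_def linear_I)
  define g where "g = mat 1 + transpose M ** M"
  \<comment> \<open>Positive definiteness of the Gram matrix makes it invertible.\<close>
  have "x = 0" if "g *v x = 0" for x
  proof -
    have "0 = x \<bullet> (g *v x)" using that by simp
    also have "\<dots> = x \<bullet> x + (M *v x) \<bullet> (M *v x)"
      by (simp add: g_def matrix_vector_mult_add_rdistrib inner_add_right
          matrix_vector_mul_assoc[symmetric] dot_lmul_matrix[symmetric] inner_commute)
    finally show ?thesis by (smt (verit) inner_ge_zero inner_eq_zero_iff)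
  qed
  then obtain h where h: "h ** g = mat 1"
    using matrix_left_invertible_ker by blast
  have g: "transpose g = g"
    by (simp add: g_def transpose_def matrix_matrix_mult_def mat_def vec_eq_iff mult.commute)
  have gh: "g ** h = mat 1" using h matrix_left_right_inverse by blast
  have "transpose (h ** g) = g ** transpose h" by (simp add: matrix_transpose_mul g)
  then have "g ** transpose h = mat 1" by (simp add: h transpose_mat)
  then have "h ** (g ** transpose h) = h" by simp
  then have hT: "transpose h = h" by (simp add: matrix_mul_assoc h)
  \<comment> \<open>Since \<open>M\<close> squares to minus the identity, \<open>g ** M\<close> is
    skew-symmetric.\<close>
  have "g *v (M *v x) = M *v x - transpose M *v x" for x
    by (simp add: g_def matrix_vector_mult_add_rdistrib matrix_vector_mul_assoc[symmetric] Mv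
        linear_neg[OF matrix_vector_mul_linear])
  then have "g ** M = M - transpose M"
    by (simp add: matrix_eq matrix_vector_mul_assoc[symmetric] matrix_vector_mult_diff_rdistrib)
  then have "h ** (g ** M) = h ** M - h ** transpose M"
    by (simp add: vec_eq_iff matrix_matrix_mult_def sum_subtractf right_diff_distrib)
  then have M: "M = h ** M - h ** transpose M" by (simp add: matrix_mul_assoc h)
  \<comment> \<open>Symmetry of \<open>h\<close> and cyclicity show that the two terms in the
    formula for \<open>M\<close> have equal traces.\<close>
  have "trace (h ** transpose M) = trace (transpose (h ** transpose M))"
    by (simp add: trace_def transpose_def)
  also have "\<dots> = trace (M ** h)" by (simp add: matrix_transpose_mul hT)
  also have "\<dots> = trace (h ** M)" by (rule trace_mul_sym)
  finally show ?thesis using M by (metis M_def diff_self trace_sub)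
qed

text \<open>Conjugation by \<open>I\<close> preserves traces, so an endomorphism and its complex linear part
  have the same trace.\<close>

lemma trace_complex_linear_part:
  fixes I L :: "real ^ 'n \<Rightarrow> real ^ 'n"
  assumes I: "complex_structure I" and L: "linear L"
    and eq: "\<And>v. L v - I (L (I v)) = 2 *\<^sub>R (a *\<^sub>R v + b *\<^sub>R I v)"
  shows "trace (matrix L) = real CARD('n) * a"
proof -
  interpret complex_structure I by fact
  have "matrix (I \<circ> L \<circ> I) = matrix I ** (matrix L ** matrix I)"
    using L linear_I by (simp add: matrix_compose linear_compose matrix_mul_assoc o_assoc)
  then have "trace (matrix (I \<circ> L \<circ> I)) = trace (matrix L ** (matrix I ** matrix I))"
    by (metis matrix_mul_assoc trace_mul_sym)
  also have "matrix L ** (matrix I ** matrix I) = matrix (L \<circ> (I \<circ> I))"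
    using L linear_I by (simp add: matrix_compose linear_compose)
  also have "trace \<dots> = - trace (matrix L)"
    by (simp add: trace_matrix linear_neg[OF L] sum_negf)
  finally have t: "trace (matrix (I \<circ> L \<circ> I)) = - trace (matrix L)" .
  have "2 * trace (matrix L) = trace (matrix L) - trace (matrix (I \<circ> L \<circ> I))" using t by simp
  also have "\<dots> = (\<Sum>i\<in>UNIV. (L (axis i 1) - I (L (I (axis i 1)))) $ i)"
    by (simp add: trace_matrix sum_subtractf)
  also have "\<dots> = (\<Sum>i\<in>(UNIV::'n set). 2 * a + 2 * b * (I (axis i 1) $ i))"
    unfolding eq by (simp add: algebra_simps axis_def)
  also have "\<dots> = 2 * a * real CARD('n) + 2 * b * trace (matrix I)"
    by (simp add: trace_matrix sum.distrib sum_distrib_left)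
  finally show ?thesis using trace_complex_structure[OF I] by simp
qed

section \<open>Connections and their torsion\<close>

context smooth_manifold
begin

text \<open>The same choice term as in \<open>endo_at\<close>, so that the endomorphism under
  \<open>Tr\<close> is directly expressed by \<open>extension\<close>.\<close>

definition extension :: "'m \<Rightarrow> real ^ 'k \<Rightarrow> ('m, 'k) vfield"
  where "extension p v = (SOME V. smooth_vfield A V \<and> V p = v)"

lemma extension: "smooth_vfield A (extension p v)" "extension p v p = v"
  using someI_ex[OF smooth_vfield_extension[of p v]] by (auto simp: extension_def)

lemma tensorial_at_extension:
  "tensorial_at p G \<Longrightarrow> smooth_vfield A X \<Longrightarrow> G X = G (extension p (X p))"
  using tensorial_at_cong[OF _ _ extension(1) extension(2)[symmetric]] .

text \<open>The chosen extensions need not depend linearly on \<open>v\<close> as fields, but the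
  relevant combinations agree at \<open>p\<close>, and only that value matters to
  \<open>G\<close>.\<close>

lemma linear_tensorial_at:
  assumes "tensorial_at p G"
  shows "linear (\<lambda>v. G (extension p v))"
proof (rule linearI)
  fix v w
  have "G (extension p (v + w)) = G (\<lambda>q. extension p v q + extension p w q)"
    by (rule tensorial_at_cong[OF assms]) (simp_all add: extension smooth_vfield_add)
  then show "G (extension p (v + w)) = G (extension p v) + G (extension p w)"
    by (simp add: tensorial_at_add[OF assms] extension)
next
  fix r v
  have "G (extension p (r *\<^sub>R v)) = G (\<lambda>q. r *\<^sub>R extension p v q)"
    by (rule tensorial_at_cong[OF assms]) (simp_all add: extension smooth_vfield_scale)
  then show "G (extension p (r *\<^sub>R v)) = r *\<^sub>R G (extension p v)"
    by (simp add: tensorial_at_scaleR[OF assms smooth_fun_const] extension)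
qed

context
  fixes D :: "('m, 'k) conn"
  assumes D: "linear_connection A D"
begin

lemma connection_smooth:
    "smooth_vfield A X \<Longrightarrow> smooth_vfield A Y \<Longrightarrow> smooth_vfield A (D X Y)"
  and connection_add1:
    "smooth_vfield A X \<Longrightarrow> smooth_vfield A X' \<Longrightarrow> smooth_vfield A Y \<Longrightarrow>
      D (\<lambda>p. X p + X' p) Y = (\<lambda>p. D X Y p + D X' Y p)"
  and connection_scaleR1:
    "smooth_fun A f \<Longrightarrow> smooth_vfield A X \<Longrightarrow> smooth_vfield A Y \<Longrightarrow>
      D (\<lambda>p. f p *\<^sub>R X p) Y = (\<lambda>p. f p *\<^sub>R D X Y p)"
  and connection_add2:
    "smooth_vfield A X \<Longrightarrow> smooth_vfield A Y \<Longrightarrow> smooth_vfield A Y' \<Longrightarrow>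
      D X (\<lambda>p. Y p + Y' p) = (\<lambda>p. D X Y p + D X Y' p)"
  and connection_scaleR2:
    "smooth_fun A f \<Longrightarrow> smooth_vfield A X \<Longrightarrow> smooth_vfield A Y \<Longrightarrow>
      D X (\<lambda>p. f p *\<^sub>R Y p) = (\<lambda>p. dir_deriv A X f p *\<^sub>R Y p + f p *\<^sub>R D X Y p)"
  using D unfolding linear_connection_def by blast+

lemma smooth_vfield_torsion:
  assumes "smooth_vfield A X" "smooth_vfield A Y"
  shows "smooth_vfield A (torsion A D X Y)"
  unfolding torsion_def[abs_def] using assms
  by (intro smooth_vfield_diff connection_smooth smooth_vfield_lie_bracket)

text \<open>The derivatives of the coefficient function produced by \<open>D X Y\<close> and by the
  bracket cancel.\<close>

lemma torsion_tensorial2: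
  assumes "smooth_vfield A X"
  shows "tensorial_at p (\<lambda>Y. torsion A D X Y p)"
  using assms
  by (auto simp: tensorial_at_def torsion_def connection_add1 connection_add2 connection_scaleR1
      connection_scaleR2 lie_bracket_add lie_bracket_scaleR algebra_simps)

end

lemma torsion_skew: "torsion A D X Y p = - torsion A D Y X p"
  by (simp add: torsion_def lie_bracket_skew[of X Y])

lemma tensorial_at_uminus: "tensorial_at p G \<Longrightarrow> tensorial_at p (\<lambda>X. - G X)"
  by (simp add: tensorial_at_def)

lemma torsion_tensorial1:
  assumes "linear_connection A D" "smooth_vfield A Y"
  shows "tensorial_at p (\<lambda>X. torsion A D X Y p)"
  using tensorial_at_uminus[OF torsion_tensorial2[OF assms]] by (simp flip: torsion_skew)

text \<open>Both connections have the same Leibniz term.\<close>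

lemma connection_difference_tensorial:
  assumes "linear_connection A D" "linear_connection A D'"
  shows "smooth_vfield A X \<Longrightarrow> tensorial_at p (\<lambda>Y. D X Y p - D' X Y p)"
    and "smooth_vfield A Y \<Longrightarrow> tensorial_at p (\<lambda>X. D X Y p - D' X Y p)"
  using assms by (auto simp: tensorial_at_def connection_add1 connection_add2 connection_scaleR1
      connection_scaleR2 algebra_simps)

end

locale almost_complex_manifold = smooth_manifold A
  for A :: "('m::{t2_space, second_countable_topology}, 'k::finite) chart set" +
  fixes J :: "('m, 'k) endofield"
  assumes almost_complex: "almost_complex A J"
begin

sublocale J: complex_structure "J p" for p
  by (rule complex_structure.intro) (use almost_complex in \<open>simp_all add: almost_complex_def\<close>)

lemmas J_simps = J.I_simps

lemma app_app: "app J (app J X) = (\<lambda>p. - X p)"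
  by (simp add: app_def)

lemma app_add: "app J (\<lambda>p. X p + Y p) = (\<lambda>p. app J X p + app J Y p)"
  and app_scaleR: "app J (\<lambda>p. f p *\<^sub>R X p) = (\<lambda>p. f p *\<^sub>R app J X p)"
  by (simp_all add: app_def J_simps)

lemma smooth_vfield_app:
  assumes "smooth_vfield A X"
  shows "smooth_vfield A (app J X)"
proof (rule smooth_vfieldI)
  \<comment> \<open>The coordinate expression of \<open>J\<close> in chart \<open>c\<close>. Its
    smoothness is given for fixed \<open>v\<close>, and \<open>smooth_on_linear_apply\<close>
    extends it to a varying argument.\<close>
  define L where "L c x v = (let p = cinv c x; d = chart_at A p in
      coord_change d c p (J p (coord_change c d p v)))" for c x v
  fix c assume c: "c \<in> A"
  show "smooth_on (cmap c ` cdom c) (\<lambda>x. L c x (local_rep A c X x))"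
  proof (rule smooth_on_linear_apply[where L = "L c" and u = "local_rep A c X", OF open_image_cdom[OF c]])
    fix x assume x: "x \<in> cmap c ` cdom c"
    then have "linear (coord_change c (chart_at A (cinv c x)) (cinv c x))"
      "linear (coord_change (chart_at A (cinv c x)) c (cinv c x))"
      using c by (auto intro!: linear_coord_change chart_at)
    from linear_compose[OF linear_compose[OF this(1) J.linear_I[of "cinv c x"]] this(2)]
    show "linear (L c x)" by (simp add: L_def[abs_def] Let_def o_def)
  next
    show "smooth_on (cmap c ` cdom c) (\<lambda>x. L c x v)" for v
      using almost_complex c unfolding almost_complex_def L_def by blast
  qed (rule smooth_vfieldD[OF assms c])
  show "coord_change (chart_at A p) c p (app J X p) = L c (cmap c p) (local_rep A c X (cmap c p))"
    if "p \<in> cdom c" for p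
    using c that
    by (simp add: L_def Let_def app_def coord_change_local_rep chart_at local_rep_chart_at)
qed

text \<open>\<open>J\<close> commutes with \<open>D\<close>, so all covariant derivatives cancel and
  the brackets remain. The right-hand side is four times the part of the torsion antilinear in both
  arguments.\<close>

lemma nijenhuis_eq_torsion:
  assumes D: "complex_connection A J D" and X: "smooth_vfield A X" and Y: "smooth_vfield A Y"
  shows "nijenhuis A J X Y p =
    torsion A D X Y p + J p (torsion A D (app J X) Y p) + J p (torsion A D X (app J Y) p)
    - torsion A D (app J X) (app J Y) p"
proof -
  have DJ: "D U (app J V) p = J p (D U V p)" if "smooth_vfield A U" "smooth_vfield A V" for U V
    using D that by (simp add: complex_connection_def app_def)
  show ?thesis
    using X Y by (simp add: nijenhuis_def torsion_def DJ smooth_vfield_app J_simps)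
qed

context
  fixes D :: "('m, 'k) conn"
  assumes complex: "complex_connection A J D"
begin

lemma linear_D: "linear_connection A D"
  using complex by (simp add: complex_connection_def)

section \<open>Decomposition of the torsion by complex type\<close>

abbreviation "T \<equiv> torsion A D"

lemma T_add1: "smooth_vfield A X \<Longrightarrow> smooth_vfield A X' \<Longrightarrow> smooth_vfield A Y \<Longrightarrow>
      T (\<lambda>q. X q + X' q) Y p = T X Y p + T X' Y p"
  and T_scaleR1: "smooth_fun A f \<Longrightarrow> smooth_vfield A X \<Longrightarrow> smooth_vfield A Y \<Longrightarrow>
      T (\<lambda>q. f q *\<^sub>R X q) Y p = f p *\<^sub>R T X Y p"
  using tensorial_at_add[OF torsion_tensorial1[OF linear_D]]
    tensorial_at_scaleR[OF torsion_tensorial1[OF linear_D]] by auto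

lemma T_add2: "smooth_vfield A X \<Longrightarrow> smooth_vfield A Y \<Longrightarrow> smooth_vfield A Y' \<Longrightarrow>
      T X (\<lambda>q. Y q + Y' q) p = T X Y p + T X Y' p"
  and T_scaleR2: "smooth_fun A f \<Longrightarrow> smooth_vfield A X \<Longrightarrow> smooth_vfield A Y \<Longrightarrow>
      T X (\<lambda>q. f q *\<^sub>R Y q) p = f p *\<^sub>R T X Y p"
  using tensorial_at_add[OF torsion_tensorial2[OF linear_D]]
    tensorial_at_scaleR[OF torsion_tensorial2[OF linear_D]] by auto

lemma T_minus1: "smooth_vfield A X \<Longrightarrow> smooth_vfield A Y \<Longrightarrow> T (\<lambda>q. - X q) Y p = - T X Y p"
  and T_minus2: "smooth_vfield A X \<Longrightarrow> smooth_vfield A Y \<Longrightarrow> T X (\<lambda>q. - Y q) p = - T X Y p"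
  using T_scaleR1[OF smooth_fun_const[of "-1"]] T_scaleR2[OF smooth_fun_const[of "-1"]] by simp_all

lemmas T_simps = T_add1 T_add2 T_scaleR1 T_scaleR2 T_minus1 T_minus2

text \<open>The complex bilinear part of the torsion.\<close>

definition T20 :: "('m, 'k) vfield \<Rightarrow> ('m, 'k) vfield \<Rightarrow> ('m, 'k) vfield"
  where "T20 X Y p = (1/4) *\<^sub>R (T X Y p - J p (T (app J X) Y p) - J p (T X (app J Y) p)
    - T (app J X) (app J Y) p)"

text \<open>The part antilinear in the first and linear in the second argument; skewness of
  \<open>T\<close> makes it determine the opposite mixed part.\<close>

definition T11 :: "('m, 'k) vfield \<Rightarrow> ('m, 'k) vfield \<Rightarrow> ('m, 'k) vfield"
  where "T11 X Y p = (1/4) *\<^sub>R (T X Y p + J p (T (app J X) Y p) - J p (T X (app J Y) p)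
    + T (app J X) (app J Y) p)"

text \<open>Subtracting half of the complex bilinear part and all of the antilinear-linear part
  removes from the torsion everything but its antilinear-antilinear part.\<close>

definition corrected_connection :: "('m, 'k) conn"
  where "corrected_connection X Y p = D X Y p - ((1/2) *\<^sub>R T20 X Y p + T11 X Y p)"

lemmas corrected_simps = corrected_connection_def T20_def T11_def

lemma smooth_vfield_app_fun: "smooth_vfield A X \<Longrightarrow> smooth_vfield A (\<lambda>p. J p (X p))"
  using smooth_vfield_app[of X] by (simp add: app_def[abs_def])

text \<open>The correction is tensorial and complex linear in its second argument, so it disturbs
  neither the Leibniz rule nor the parallelism of \<open>J\<close>.\<close>

lemma complex_connection_corrected: "complex_connection A J corrected_connection"
  unfolding complex_connection_def linear_connection_def
proof (intro conjI allI impI)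
  fix X Y assume "smooth_vfield A X" "smooth_vfield A Y"
  then show "smooth_vfield A (corrected_connection X Y)"
    unfolding corrected_connection_def[abs_def] T20_def T11_def
    by (intro smooth_vfield_diff smooth_vfield_add smooth_vfield_scale smooth_vfield_app_fun
        connection_smooth[OF linear_D] smooth_vfield_torsion[OF linear_D] smooth_vfield_app)
next
  fix X X' Y assume "smooth_vfield A X" "smooth_vfield A X'" "smooth_vfield A Y"
  then show "corrected_connection (\<lambda>p. X p + X' p) Y =
      (\<lambda>p. corrected_connection X Y p + corrected_connection X' Y p)"
    by (simp add: fun_eq_iff corrected_simps app_add T_simps smooth_vfield_app J_simps
        connection_add1[OF linear_D] algebra_simps)
next
  fix X Y Y' assume "smooth_vfield A X" "smooth_vfield A Y" "smooth_vfield A Y'"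
  then show "corrected_connection X (\<lambda>p. Y p + Y' p) =
      (\<lambda>p. corrected_connection X Y p + corrected_connection X Y' p)"
    by (simp add: fun_eq_iff corrected_simps app_add T_simps smooth_vfield_app J_simps
        connection_add2[OF linear_D] algebra_simps)
next
  fix f X Y assume "smooth_fun A f" "smooth_vfield A X" "smooth_vfield A Y"
  then show "corrected_connection (\<lambda>p. f p *\<^sub>R X p) Y = (\<lambda>p. f p *\<^sub>R corrected_connection X Y p)"
    by (simp add: fun_eq_iff corrected_simps app_scaleR T_simps smooth_vfield_app J_simps
        connection_scaleR1[OF linear_D] algebra_simps)
next
  fix f X Y assume "smooth_fun A f" "smooth_vfield A X" "smooth_vfield A Y"
  then show "corrected_connection X (\<lambda>p. f p *\<^sub>R Y p) =
      (\<lambda>p. dir_deriv A X f p *\<^sub>R Y p + f p *\<^sub>R corrected_connection X Y p)"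
    by (simp add: fun_eq_iff corrected_simps app_scaleR T_simps smooth_vfield_app J_simps
        connection_scaleR2[OF linear_D] algebra_simps)
next
  fix X Y assume XY: "smooth_vfield A X" "smooth_vfield A Y"
  then have "D X (app J Y) = app J (D X Y)" using complex by (simp add: complex_connection_def)
  with XY show "corrected_connection X (app J Y) = app J (corrected_connection X Y)"
    by (simp add: fun_eq_iff corrected_simps app_app T_simps smooth_vfield_app J_simps
        app_def[of J "D X Y"] app_def[of J "corrected_connection X Y"] algebra_simps)
qed

text \<open>Antisymmetrising the correction gives all of \<open>T20\<close>, which is itself skew,
  and both mixed parts; what is left of the torsion is a quarter of
  \<open>nijenhuis\<close>.\<close>

lemma minimal_connection_corrected: "minimal_connection A J corrected_connection"
  unfolding minimal_connection_def
proof (intro allI impI)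
  fix X Y p assume X: "smooth_vfield A X" and Y: "smooth_vfield A Y"
  \<comment> \<open>With these terms as atoms and skewness for swapped arguments, the claim is
    linear arithmetic.\<close>
  define t1 t2 t3 t4 where t: "t1 = T X Y p" "t2 = J p (T (app J X) Y p)"
    "t3 = J p (T X (app J Y) p)" "t4 = T (app J X) (app J Y) p"
  have skew: "T Y X p = - t1" "J p (T (app J Y) X p) = - t3" "J p (T Y (app J X) p) = - t2"
    "T (app J Y) (app J X) p = - t4"
    unfolding t by (subst torsion_skew, simp add: J_simps)+
  have "torsion A corrected_connection X Y p =
      T X Y p - ((1/2) *\<^sub>R T20 X Y p + T11 X Y p) + ((1/2) *\<^sub>R T20 Y X p + T11 Y X p)"
    by (simp add: torsion_def corrected_connection_def)
  also have "\<dots> = (1/4) *\<^sub>R (t1 + t2 + t3 - t4)"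
    unfolding T20_def T11_def skew t[symmetric] by (simp add: vec_eq_iff field_simps)
  also have "\<dots> = (1/4) *\<^sub>R nijenhuis A J X Y p"
    unfolding nijenhuis_eq_torsion[OF complex X Y] t ..
  finally show "torsion A corrected_connection X Y p = (1/4) *\<^sub>R nijenhuis A J X Y p" .
qed

section \<open>The traceless part and c-projective equivalence\<close>

lemma pi4_torsion_eq:
  "pi4_torsion n A J D X Y p = T11 X Y p -
     (1 / (2 * real n)) *\<^sub>R (varsigma A J D X p *\<^sub>R Y p + varsigma A J D (app J X) p *\<^sub>R J p (Y p))"
  by (simp add: pi4_torsion_def T11_def)

text \<open>On the diagonal \<open>T20\<close> vanishes by skewness, and the hypothesis reduces
  \<open>T11\<close> to its trace term, a combination of \<open>X\<close> and
  \<open>J X\<close>.\<close>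

lemma cproj_equiv_corrected:
  assumes "\<And>X Y p. smooth_vfield A X \<Longrightarrow> smooth_vfield A Y \<Longrightarrow> pi4_torsion n A J D X Y p = 0"
  shows "cproj_equiv A J D corrected_connection"
  unfolding cproj_equiv_def
proof (intro allI impI)
  fix X p assume X: "smooth_vfield A X"
  have TT: "T Z Z p = 0" for Z
    using torsion_skew[of D Z Z p] by (simp add: eq_neg_iff_add_eq_0 vec_eq_iff)
  have "T20 X X p = 0"
    using torsion_skew[of D "app J X" X p] by (simp add: T20_def TT J_simps)
  moreover have "T11 X X p = (1 / (2 * real n)) *\<^sub>R
      (varsigma A J D X p *\<^sub>R X p + varsigma A J D (app J X) p *\<^sub>R J p (X p))"
    using assms[OF X X, of p] by (simp add: pi4_torsion_eq)
  ultimately show "D X X p - corrected_connection X X p \<in> span {X p, J p (X p)}"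
    by (simp add: corrected_connection_def span_add span_scale span_base)
qed

text \<open>If \<open>2 T11 X\<close> is multiplication by a complex scalar, \<open>varsigma\<close>
  recovers its real part. The imaginary part is obtained later by replacing \<open>X\<close> with
  \<open>J X\<close>.\<close>

lemma varsigma_eq:
  assumes X: "smooth_vfield A X"
    and ab: "\<And>V. smooth_vfield A V \<Longrightarrow> 2 *\<^sub>R T11 X V p = a *\<^sub>R V p + b *\<^sub>R J p (V p)"
  shows "varsigma A J D X p = real CARD('k) / 2 * a"
proof -
  define G where "G V = T X V p + J p (T (app J X) V p)" for V
  have G: "tensorial_at p G"
    using X by (auto simp: tensorial_at_def G_def T_simps smooth_vfield_app J_simps algebra_simps)
  define L where "L v = G (extension p v)" for v
  have L: "linear L" unfolding L_def by (rule linear_tensorial_at[OF G])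
  \<comment> \<open>Twice the complex linear part of the endomorphism under the trace is
    \<open>4 T11 X\<close>.\<close>
  have "L v - J p (L (J p v)) = 2 *\<^sub>R (a *\<^sub>R v + b *\<^sub>R J p v)" for v
  proof -
    let ?V = "extension p v"
    have V: "smooth_vfield A ?V" "?V p = v" by (rule extension)+
    have "G (app J ?V) = L (J p v)"
      using tensorial_at_extension[OF G smooth_vfield_app[OF V(1)]] V(2) by (simp add: L_def app_def)
    then have "L v - J p (L (J p v)) = G ?V - J p (G (app J ?V))" by (simp add: L_def)
    also have "\<dots> = 4 *\<^sub>R T11 X ?V p" by (simp add: G_def T11_def J_simps)
    also have "\<dots> = 2 *\<^sub>R (2 *\<^sub>R T11 X ?V p)" by simp
    also have "\<dots> = 2 *\<^sub>R (a *\<^sub>R v + b *\<^sub>R J p v)" using ab[OF V(1)] V(2) by simp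
    finally show ?thesis .
  qed
  from trace_complex_linear_part[OF J.complex_structure_axioms L this]
  have "trace (matrix L) = real CARD('k) * a" .
  moreover have "endo_at A (\<lambda>V q. T X V q + J q (T (app J X) V q)) p = L"
    by (simp add: fun_eq_iff endo_at_def L_def G_def extension_def)
  ultimately show ?thesis by (simp add: varsigma_def Tr_def)
qed

text \<open>The minimal torsion is antilinear in both arguments and has no \<open>T11\<close> part.
  The difference \<open>B\<close> is complex linear in its second argument, so \<open>B Y X\<close>
  is linear in \<open>X\<close> and contributes nothing; only the antilinear part of
  \<open>B X Y\<close> in \<open>X\<close> survives.\<close>

lemma T11_of_minimal:
  assumes D': "complex_connection A J D'" and min: "minimal_connection A J D'"
    and X: "smooth_vfield A X" and Y: "smooth_vfield A Y"
  shows "2 *\<^sub>R T11 X Y p = (D X Y p - D' X Y p) + J p (D (app J X) Y p - D' (app J X) Y p)"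
proof -
  note JX = smooth_vfield_app[OF X] and JY = smooth_vfield_app[OF Y]
  let ?T' = "torsion A D'"
  have lin': "linear_connection A D'" using D' by (simp add: complex_connection_def)
  have anti1: "?T' (app J U) V p = - J p (?T' U V p)" if U: "smooth_vfield A U" and V: "smooth_vfield A V" for U V
  proof -
    note JU = smooth_vfield_app[OF U]
    \<comment> \<open>Minimality combined with \<open>nijenhuis_eq_torsion\<close> for
      \<open>D'\<close> itself says that its torsion equals its own antilinear-antilinear
      part.\<close>
    have N: "4 *\<^sub>R ?T' Z V p = ?T' Z V p + J p (?T' (app J Z) V p) + J p (?T' Z (app J V) p)
        - ?T' (app J Z) (app J V) p" if "smooth_vfield A Z" for Z
      using min that V nijenhuis_eq_torsion[OF D' that V, of p] by (simp add: minimal_connection_def)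
    have neg: "?T' (\<lambda>q. - U q) Z p = - ?T' U Z p" if "smooth_vfield A Z" for Z
      using tensorial_at_scaleR[OF torsion_tensorial1[OF lin' that] smooth_fun_const[of "- 1"] U] by simp
    have "4 *\<^sub>R ?T' (app J U) V p = - J p (4 *\<^sub>R ?T' U V p)"
      unfolding N[OF U] N[OF JU] app_app using V by (simp add: neg smooth_vfield_app J_simps)
    then show ?thesis by (simp add: J_simps flip: scaleR_minus_right)
  qed
  have anti2: "?T' U (app J V) p = - J p (?T' U V p)" if "smooth_vfield A U" "smooth_vfield A V" for U V
    using anti1[OF that(2,1)] torsion_skew[of D' U "app J V" p] torsion_skew[of D' V U p]
    by (simp add: J_simps)
  define B where "B U V = D U V p - D' U V p" for U V
  have BJ: "B U (app J V) = J p (B U V)" if "smooth_vfield A U" "smooth_vfield A V" for U V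
    using complex D' that by (simp add: B_def complex_connection_def app_def J_simps)
  \<comment> \<open>The bracket is common to both torsions.\<close>
  have T: "T U V p = ?T' U V p + B U V - B V U" for U V
    by (simp add: torsion_def B_def)
  show ?thesis
    unfolding T11_def T B_def[symmetric]
    using X Y JX JY by (simp add: anti1 anti2 BJ J_simps vec_eq_iff)
qed

lemma pi4_torsion_eq_zero:
  assumes n: "CARD('k) = 2 * n"
    and D': "complex_connection A J D'" "cproj_equiv A J D D'" and min: "minimal_connection A J D'"
    and X: "smooth_vfield A X" and Y: "smooth_vfield A Y"
  shows "pi4_torsion n A J D X Y p = 0"
proof -
  define B where "B U V = D U V p - D' U V p" for U V
  have lin: "linear_connection A D" "linear_connection A D'"
    using linear_D D' by (simp_all add: complex_connection_def)
  have B: "smooth_vfield A U \<Longrightarrow> tensorial_at p (B U)" "smooth_vfield A V \<Longrightarrow> tensorial_at p (\<lambda>U. B U V)" for U V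
    using connection_difference_tensorial[OF lin] unfolding B_def by blast+
  have BJ: "B U (app J V) = J p (B U V)" if "smooth_vfield A U" "smooth_vfield A V" for U V
    using complex D' that by (simp add: B_def complex_connection_def app_def J_simps)
  \<comment> \<open>The bilinear map on the tangent space at \<open>p\<close> induced by
    \<open>B\<close>.\<close>
  define b where "b v w = B (extension p v) (extension p w)" for v w
  have b: "B U V = b (U p) (V p)" if "smooth_vfield A U" "smooth_vfield A V" for U V
    using tensorial_at_extension[OF B(1)[OF that(1)] that(2)]
      tensorial_at_extension[OF B(2)[OF extension(1)[of p "V p"]] that(1)]
    unfolding b_def by (rule trans)
  have b_lin: "linear (b v)" "linear (\<lambda>v. b v w)" for v w
    unfolding b_def by (intro linear_tensorial_at B extension)+
  have bJ: "b v (J p w) = J p (b v w)" for v w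
  proof -
    have "app J (extension p w) p = J p w" by (simp add: app_def extension)
    then show ?thesis
      using BJ[OF extension(1) extension(1), of p v p w]
        b[OF extension(1) smooth_vfield_app[OF extension(1)], of p v p w]
      by (simp add: extension(2) b_def)
  qed
  have b_diag: "b v v \<in> span {v, J p v}" for v
    using D'(2) extension(1)[of p v] extension(2)[of p v] unfolding cproj_equiv_def b_def B_def by metis
  \<comment> \<open>Twice the part of \<open>b\<close> that is antilinear in the first
    argument.\<close>
  define Q where "Q v w = b v w + J p (b (J p v) w)" for v w
  have "\<exists>c d. \<forall>w. Q v w = c *\<^sub>R w + d *\<^sub>R J p w" for v
  proof (rule J.sesquilinear_diagonal)
    show "linear (Q v)" for v
      unfolding Q_def
      by (rule linearI) (simp_all add: linear_add[OF b_lin(1)] linear_scale[OF b_lin(1)] J_simps algebra_simps)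
    show "linear (\<lambda>v. Q v w)" for w
      unfolding Q_def
      by (rule linearI) (simp_all add: linear_add[OF b_lin(2)] linear_scale[OF b_lin(2)] J_simps algebra_simps)
    show "Q (J p v) w = - J p (Q v w)" "Q v (J p w) = J p (Q v w)" for v w
      by (simp_all add: Q_def bJ linear_neg[OF b_lin(2)] J_simps)
    show "Q u u \<in> span {u, J p u}" for u
    proof -
      \<comment> \<open>The second summand of \<open>Q u u\<close> is \<open>b (J u) (J u)\<close>,
        and \<open>J u\<close> spans the same complex line as \<open>u\<close>.\<close>
      have "{J p u, J p (J p u)} \<subseteq> span {u, J p u}"
        by (simp add: span_base span_neg)
      then have "b (J p u) (J p u) \<in> span {u, J p u}"
        using b_diag[of "J p u"] span_minimal subspace_span by blast
      then show ?thesis using b_diag[of u] by (simp add: Q_def flip: bJ) (rule span_add)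
    qed
  qed
  then obtain c d where cd: "\<And>w. Q (X p) w = c *\<^sub>R w + d *\<^sub>R J p w" by meson
  have T11: "2 *\<^sub>R T11 U V p = Q (U p) (V p)" if "smooth_vfield A U" "smooth_vfield A V" for U V
    using T11_of_minimal[OF D'(1) min that, of p] b that smooth_vfield_app
    by (simp add: Q_def app_def flip: B_def)
  have s1: "varsigma A J D X p = real n * c"
    using varsigma_eq[OF X, of p c d] T11[OF X] cd n by simp
  \<comment> \<open>Passing to \<open>J X\<close> multiplies the scalar by minus the imaginary unit,
    so its real part becomes \<open>d\<close>.\<close>
  have "Q (J p (X p)) w = - J p (Q (X p) w)" for w
    by (simp add: Q_def linear_neg[OF b_lin(2)] J_simps)
  then have "2 *\<^sub>R T11 (app J X) V p = d *\<^sub>R V p + (- c) *\<^sub>R J p (V p)" if "smooth_vfield A V" for V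
    using T11[OF smooth_vfield_app[OF X] that] cd by (simp add: app_def J_simps)
  then have s2: "varsigma A J D (app J X) p = real n * d"
    using varsigma_eq[OF smooth_vfield_app[OF X], of p d "- c"] n by simp
  have "real n > 0" using n zero_less_card_finite[where 'a = 'k] by simp
  moreover have "T11 X Y p = (1/2) *\<^sub>R (2 *\<^sub>R T11 X Y p)" by simp
  ultimately show ?thesis
    unfolding pi4_torsion_eq s1 s2 T11[OF X Y] cd
    by (simp add: scaleR_add_right)
qed

end

end

theorem corollary3:
  fixes n :: nat
    and A :: "('m::{t2_space, second_countable_topology}, 'k::finite) chart set"
    and J :: "('m, 'k) endofield"
    and D :: "('m, 'k) conn"
  assumes "n \<ge> 2"
    and "CARD('k) = 2 * n"
    and "smooth_atlas A"
    and "almost_complex A J"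
    and "complex_connection A J D"
  shows "(\<exists>D' \<in> cproj_class A J D. minimal_connection A J D') \<longleftrightarrow>
         (\<forall>X Y. smooth_vfield A X \<longrightarrow> smooth_vfield A Y \<longrightarrow>
            (\<forall>p. pi4_torsion n A J D X Y p = 0))"
proof -
  interpret almost_complex_manifold A J
    using assms by unfold_locales
  show ?thesis
  proof
    assume "\<exists>D' \<in> cproj_class A J D. minimal_connection A J D'"
    then show "\<forall>X Y. smooth_vfield A X \<longrightarrow> smooth_vfield A Y \<longrightarrow>
            (\<forall>p. pi4_torsion n A J D X Y p = 0)"
      using pi4_torsion_eq_zero[OF assms(5,2)] unfolding cproj_class_def by blast
  next
    assume "\<forall>X Y. smooth_vfield A X \<longrightarrow> smooth_vfield A Y \<longrightarrow>
            (\<forall>p. pi4_torsion n A J D X Y p = 0)"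
    then have "cproj_equiv A J D (corrected_connection D)"
      by (intro cproj_equiv_corrected[OF assms(5)]) blast
    then show "\<exists>D' \<in> cproj_class A J D. minimal_connection A J D'"
      using complex_connection_corrected[OF assms(5)] minimal_connection_corrected[OF assms(5)]
      unfolding cproj_class_def by blast
  qed
qed

end
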